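(* With the data of the context, for all $t\in(t^*,T]=(\tfrac73,3]$ the sets $$\left(N_{\Sigma-\bm{\widetilde\sigma}(t)}(\bm y(t))+\frac{d}{dt}\bm y(t)\right)\cap\mathcal{U}\qquad\text{and}\qquad\left(N_{\Sigma-\bm{\widetilde\sigma}(t)}(\bm y(t))+\frac{d}{dt}\bm y(t)\right)\cap\mathcal{U}+\frac{d}{dt}\bm{\widetilde\sigma}(t)$$ are empty. Therefore, for any $\bm\varepsilon_{\bf 0}$, the problem $$-\frac{d}{dt}\bm y\in N_{\mathcal{C}(t)}(\bm y),\qquad \frac{d}{dt}\bm\varepsilon\in\left(N_{\Sigma-\bm{\widetilde\sigma}(t)}(\bm y)+\frac{d}{dt}\bm y\right)\cap\mathcal{U}+\frac{d}{dt}\bm{\widetilde\sigma}(t)\qquad\text{for a.a. }t\in I,$$ $$\bm y(t)\in\mathcal{C}(t)=(\Sigma-\bm{\widetilde\sigma}(t))\cap\mathcal{V}\ \text{ for all }t\in I,\qquad \bm y(0)=0,\qquad\bm\varepsilon(0)=\bm\varepsilon_{\bf 0},$$ has no solution $(y,\varepsilon)\in W^{1,\infty}(I,L^2(\Omega))\times W^{1,\infty}(I,L^2(\Omega))$, and the problem of quasi-static evolution of the elastic-perfectly plastic rod (stated in the context) has no solution $\varepsilon,\varepsilon_{\rm el},\varepsilon_{\rm p},\sigma\in W^{1,\infty}(I,L^2(\Omega))$.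
   Context: $\Omega=(-1,1)$, $I=[0,T]$ with $T=3$, $t^*=\tfrac73$. All normal cones are taken in $L^2(\Omega)$ with its usual inner product: $N_{\mathcal C}(\bm x)=\{\bm z\in L^2(\Omega):\langle\bm z,\bm c-\bm x\rangle\le0\ \forall\bm c\in\mathcal{C}\}$ for a closed convex nonempty $\mathcal{C}$ and $\bm x\in\mathcal C$. The rod has stiffness $\bm C(x)\equiv1$ (so $\mathbf C$ is the identity on $L^2(\Omega)$) and yield limits $\sigma^-\equiv-1$, $\sigma^+\equiv1$, i.e. $\Sigma=\{\bm\sigma\in L^2(\Omega):-1\le\sigma(x)\le1\text{ for a.a. }x\in\Omega\}$. The fundamental subspaces are $\mathcal{V}$ = constant functions in $L^2(\Omega)$ and $\mathcal{U}=\{\bm\sigma\in L^2(\Omega):\int_\Omega\sigma\,dx=0\}$. Loads: body force $F(t,x)=2xt$ for $t\in[0,1)$ and $F(t,x)=2x$ for $t\in[1,T]$; boundary displacements $u_a(t)\equiv0$ at $x=-1$, and $u_b(t)=0$ for $t\in[0,1)$, $u_b(t)=t-1$ for $t\in[1,T]$ at $x=1$. Set $u_{\rm D}(t,x)=\frac{1-x}{2}u_a(t)+\frac{x+1}{2}u_b(t)$ and $\bm g(t)=\partial_xu_{\rm D}(t,\cdot)$. The corresponding stress solution for elasticity is $$\widetilde\sigma(t,x)=\begin{cases}t\left(\frac13-x^2\right),&t\in[0,1),\\ \frac12(t-1)+\frac13-x^2,&t\in[1,T].\end{cases}$$ The solution of the sweeping process $-\frac{d}{dt}\bm y\in N_{\mathcal{C}(t)}(\bm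 y)$, $\bm y(0)=0$, is $y(t,x)=0$ for $t\in[0,t^* )$ and $y(t,x)=-\frac12(t-t^* )$ for $t\in[t^*,T]$, with $\frac{d}{dt}y(t,x)=-\frac12$ on $(t^*,T]$ (left derivative at $t=T$). In the claim, the sets displayed for $t\in(t^*,T]$ are formed with this $\bm y$. The problem of quasi-static evolution of the elastic-perfectly plastic rod with these data: find $\varepsilon,\varepsilon_{\rm el},\varepsilon_{\rm p},\sigma\in W^{1,\infty}(I,L^2(\Omega))$ such that for all $t\in I$: $\bm\varepsilon\in\{\frac{d}{dx}u:u\in W^{1,2}_0(\Omega)\}+\bm g(t)$; $\bm\varepsilon=\bm{\varepsilon_{\bf el}}+\bm{\varepsilon_{\bf p}}$; $\bm\sigma=\bm{\varepsilon_{\bf el}}$; $\bm\sigma\in W^{1,2}(\Omega)$ and $-\frac{d}{dx}\bm\sigma=\bm F(t)$; for a.a. $t\in I$: $\frac{d}{dt}\bm{\varepsilon_{\bf p}}\in N_\Sigma(\bm\sigma)$ (in particular $\bm\sigma\in\Sigma$); with initial conditions $\bm\sigma(0)=\bm{\varepsilon_{\bf el}}(0)=0$, $\bm\varepsilon(0)=\bm{\varepsilon_{\bf p}}(0)=\bm\varepsilon_{\bf 0}$, for an arbitrary admissible $\bm\varepsilon_{\bf 0}$, i.e. $\bm\varepsilon_{\bf 0}\in\mathcal{U}$. *)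

theory Defs
  imports "HOL-Analysis.Analysis"
begin

section \<open>The Hilbert space of square integrable functions on (-1,1)\<close>

abbreviation Omega :: "real set" where "Omega \<equiv> {-1<..<1}"

definition square_integrable :: "(real \<Rightarrow> real) \<Rightarrow> bool" where
  "square_integrable f \<longleftrightarrow> f \<in> borel_measurable (lebesgue_on Omega) \<and>
     integrable (lebesgue_on Omega) (\<lambda>x. (f x)\<^sup>2)"

lemma square_integrable_measurable [measurable_dest]:
  "square_integrable f \<Longrightarrow> f \<in> borel_measurable (lebesgue_on Omega)"
  by (simp add: square_integrable_def)

lemma square_integrable_mult:
  assumes "square_integrable f" "square_integrable g"
  shows "integrable (lebesgue_on Omega) (\<lambda>x. f x * g x)"
proof (rule Bochner_Integration.integrable_bound)
  show "integrable (lebesgue_on Omega) (\<lambda>x. (f x)\<^sup>2 + (g x)\<^sup>2)"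
    using assms by (auto simp: square_integrable_def)
  show "(\<lambda>x. f x * g x) \<in> borel_measurable (lebesgue_on Omega)"
    using assms by (auto simp: square_integrable_def)
  have "\<bar>f x * g x\<bar> \<le> (f x)\<^sup>2 + (g x)\<^sup>2" for x
    using sum_squares_bound[of "\<bar>f x\<bar>" "\<bar>g x\<bar>"] zero_le_power2[of "f x"] zero_le_power2[of "g x"]
    by (simp add: abs_mult mult.assoc)
      (smt (verit) abs_ge_zero mult_nonneg_nonneg)
  then show "AE x in lebesgue_on Omega. norm (f x * g x) \<le> norm ((f x)\<^sup>2 + (g x)\<^sup>2)"
    by simp
qed

lemma square_integrable_add:
  assumes "square_integrable f" "square_integrable g"
  shows "square_integrable (\<lambda>x. f x + g x)"
  unfolding square_integrable_def power2_sum
  using assms square_integrable_mult[OF assms]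
  by (auto simp: square_integrable_def mult.assoc)

lemma square_integrable_scale:
  "square_integrable f \<Longrightarrow> square_integrable (\<lambda>x. c * f x)"
  by (auto simp: square_integrable_def power_mult_distrib)

lemma square_integrable_diff:
  assumes "square_integrable f" "square_integrable g"
  shows "square_integrable (\<lambda>x. f x - g x)"
  using square_integrable_add[OF assms(1) square_integrable_scale[OF assms(2), of "-1"]] by simp

lemma square_integrable_dominated:
  assumes "f \<in> borel_measurable (lebesgue_on Omega)" "square_integrable w"
    "AE x in lebesgue_on Omega. \<bar>f x\<bar> \<le> \<bar>w x\<bar>"
  shows "square_integrable f"
  unfolding square_integrable_def
proof
  show "integrable (lebesgue_on Omega) (\<lambda>x. (f x)\<^sup>2)"
  proof (rule Bochner_Integration.integrable_bound)
    show "integrable (lebesgue_on Omega) (\<lambda>x. (w x)\<^sup>2)"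
      using assms by (simp add: square_integrable_def)
    show "AE x in lebesgue_on Omega. norm ((f x)\<^sup>2) \<le> norm ((w x)\<^sup>2)"
      using assms(3) by eventually_elim (simp add: abs_le_square_iff)
  qed (use assms in simp)
qed fact

lemma square_integrable_const [simp]: "square_integrable (\<lambda>x. c)"
  by (auto simp: square_integrable_def intro!: finite_measure.integrable_const finite_measure_lebesgue_on)

text \<open>
  \<open>L2\<close> consists of the square integrable functions modulo equality almost everywhere;
  \<open>L2 f\<close> is the class of \<open>f\<close> (meaningful only if \<open>square_integrable f\<close>) and
  \<open>rep_L2\<close> picks a representative.
\<close>

definition L2_rel :: "(real \<Rightarrow> real) \<Rightarrow> (real \<Rightarrow> real) \<Rightarrow> bool" where
  "L2_rel f g \<longleftrightarrow> square_integrable f \<and> square_integrable g \<and>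
     (AE x in lebesgue_on Omega. f x = g x)"

quotient_type L2 = "real \<Rightarrow> real" / partial: L2_rel
  morphisms rep_L2 L2
proof (rule part_equivpI)
  show "\<exists>f. L2_rel f f"
    by (rule exI[of _ "\<lambda>x. 0"]) (simp add: L2_rel_def)
  show "symp L2_rel"
    by (rule sympI) (auto simp: L2_rel_def elim: eventually_mono)
  show "transp L2_rel"
    by (rule transpI) (auto simp: L2_rel_def elim: eventually_elim2)
qed

lemma square_integrable_rep [simp]: "square_integrable (rep_L2 f)"
  using Quotient_rep_reflp[OF Quotient_L2, of f] by (simp add: L2_rel_def)

lemma L2_rep [simp]: "L2 (rep_L2 f) = f"
  using Quotient_abs_rep[OF Quotient_L2] .

lemma L2_eq_iff:
  assumes "square_integrable f" "square_integrable g"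
  shows "L2 f = L2 g \<longleftrightarrow> (AE x in lebesgue_on Omega. f x = g x)"
  using assms Quotient_rel[OF Quotient_L2, of f g] by (auto simp: L2_rel_def)

lemma rep_L2_AE:
  assumes "square_integrable f"
  shows "AE x in lebesgue_on Omega. rep_L2 (L2 f) x = f x"
  using assms by (simp add: L2_eq_iff[symmetric])

instantiation L2 :: real_vector
begin

lift_definition zero_L2 :: L2 is "\<lambda>x. 0"
  by (simp add: L2_rel_def)

lift_definition plus_L2 :: "L2 \<Rightarrow> L2 \<Rightarrow> L2" is "\<lambda>f g x. f x + g x"
  by (auto simp: L2_rel_def square_integrable_add elim: eventually_elim2)

lift_definition minus_L2 :: "L2 \<Rightarrow> L2 \<Rightarrow> L2" is "\<lambda>f g x. f x - g x"
  by (auto simp: L2_rel_def square_integrable_diff elim: eventually_elim2)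

lift_definition uminus_L2 :: "L2 \<Rightarrow> L2" is "\<lambda>f x. - f x"
  using square_integrable_scale[of _ "-1"]
  by (auto simp: L2_rel_def elim: eventually_mono)

lift_definition scaleR_L2 :: "real \<Rightarrow> L2 \<Rightarrow> L2" is "\<lambda>c f x. c * f x"
  by (auto simp: L2_rel_def square_integrable_scale elim: eventually_mono)

instance
proof
  fix f g h :: L2 and c d :: real
  show "f + g + h = f + (g + h)"
    by transfer (auto simp: L2_rel_def add.assoc intro!: square_integrable_add)
  show "f + g = g + f"
    by transfer (auto simp: L2_rel_def add.commute intro!: square_integrable_add)
  show "0 + f = f"
    by transfer (auto simp: L2_rel_def)
  show "- f + f = 0"
    by transfer (auto simp: L2_rel_def)
  show "f - g = f + - g"
    by transfer (auto simp: L2_rel_def square_integrable_diff)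
  show "c *\<^sub>R (f + g) = c *\<^sub>R f + c *\<^sub>R g"
    by transfer (auto simp: L2_rel_def distrib_left intro!: square_integrable_add square_integrable_scale)
  show "(c + d) *\<^sub>R f = c *\<^sub>R f + d *\<^sub>R f"
    by transfer (auto simp: L2_rel_def distrib_right intro!: square_integrable_add square_integrable_scale)
  show "c *\<^sub>R d *\<^sub>R f = (c * d) *\<^sub>R f"
    by transfer (auto simp: L2_rel_def mult.assoc intro!: square_integrable_scale)
  show "1 *\<^sub>R f = f"
    by transfer (auto simp: L2_rel_def)
qed

end

instantiation L2 :: real_inner
begin

lift_definition inner_L2 :: "L2 \<Rightarrow> L2 \<Rightarrow> real"
  is "\<lambda>f g. LINT x|lebesgue_on Omega. f x * g x"
  unfolding L2_rel_def by (rule integral_cong_AE) (auto elim: eventually_elim2)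

definition norm_L2 :: "L2 \<Rightarrow> real" where "norm_L2 f = sqrt (inner f f)"
definition sgn_L2 :: "L2 \<Rightarrow> L2" where "sgn_L2 f = f /\<^sub>R norm f"
definition dist_L2 :: "L2 \<Rightarrow> L2 \<Rightarrow> real" where "dist_L2 f g = norm (f - g)"
definition uniformity_L2 :: "(L2 \<times> L2) filter" where
  "uniformity_L2 = (INF e\<in>{0<..}. principal {(f, g). dist f g < e})"
definition open_L2 :: "L2 set \<Rightarrow> bool" where
  "open_L2 U \<longleftrightarrow> (\<forall>x\<in>U. \<forall>\<^sub>F (x', y) in uniformity. x' = x \<longrightarrow> y \<in> U)"

instance
proof
  fix f g h :: L2 and c :: real
  show "sgn f = f /\<^sub>R norm f" by (rule sgn_L2_def)
  show "dist f g = norm (f - g)" by (rule dist_L2_def)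
  show "uniformity = (INF e\<in>{0<..}. principal {(f::L2, g). dist f g < e})"
    by (rule uniformity_L2_def)
  show "open U \<longleftrightarrow> (\<forall>x\<in>U. \<forall>\<^sub>F (x', y) in uniformity. x' = x \<longrightarrow> y \<in> U)" for U :: "L2 set"
    by (rule open_L2_def)
  show "inner f g = inner g f"
    by transfer (simp add: mult.commute)
  show "inner (f + g) h = inner f h + inner g h"
    by transfer (auto simp: L2_rel_def distrib_right square_integrable_mult)
  show "inner (c *\<^sub>R f) g = c * inner f g"
    by transfer (auto simp: L2_rel_def mult.assoc)
  show "0 \<le> inner f f"
    by transfer auto
  show "inner f f = 0 \<longleftrightarrow> f = 0"
  proof transfer
    fix f assume f: "L2_rel f f"
    then have "integrable (lebesgue_on Omega) (\<lambda>x. f x * f x)"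
      by (auto simp: L2_rel_def square_integrable_mult)
    from integral_nonneg_eq_0_iff_AE[OF this] f
    show "(LINT x|lebesgue_on Omega. f x * f x) = 0 \<longleftrightarrow> L2_rel f (\<lambda>x. 0)"
      by (auto simp: L2_rel_def)
  qed
  show "norm f = sqrt (inner f f)" by (rule norm_L2_def)
qed

end

lemma L2_diff:
  assumes "square_integrable f" "square_integrable g"
  shows "L2 f - L2 g = L2 (\<lambda>x. f x - g x)"
proof -
  have "L2 (\<lambda>x. rep_L2 (L2 f) x - rep_L2 (L2 g) x) = L2 (\<lambda>x. f x - g x)"
    using rep_L2_AE[OF assms(1)] rep_L2_AE[OF assms(2)]
    by (subst L2_eq_iff) (auto intro!: square_integrable_diff assms elim: eventually_elim2)
  then show ?thesis
    by (simp add: minus_L2_def map_fun_def)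
qed

lemma inner_L2:
  assumes "square_integrable f" "square_integrable g"
  shows "inner (L2 f) (L2 g) = (LINT x|lebesgue_on Omega. f x * g x)"
  unfolding inner_L2_def map_fun_def o_def id_def
proof (rule integral_cong_AE)
  show "AE x in lebesgue_on Omega. rep_L2 (L2 f) x * rep_L2 (L2 g) x = f x * g x"
    using rep_L2_AE[OF assms(1)] rep_L2_AE[OF assms(2)] by eventually_elim simp
qed (use assms in \<open>auto intro!: borel_measurable_times dest: square_integrable_measurable
      simp: square_integrable_measurable\<close>)

lemma norm_L2_power2:
  assumes "square_integrable f"
  shows "(norm (L2 f))\<^sup>2 = (LINT x|lebesgue_on Omega. (f x)\<^sup>2)"
  using inner_L2[OF assms assms] by (simp add: power2_norm_eq_inner) (simp add: power2_eq_square)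

lemma norm_L2_power2_nn:
  assumes "square_integrable f"
  shows "(\<integral>\<^sup>+x. ennreal ((f x)\<^sup>2) \<partial>lebesgue_on Omega) = ennreal ((norm (L2 f))\<^sup>2)"
  using assms by (simp add: norm_L2_power2 square_integrable_def nn_integral_eq_integral)

lemma L2_tendsto_dominated:
  assumes f: "\<And>n. f n \<in> borel_measurable (lebesgue_on Omega)"
    and g: "g \<in> borel_measurable (lebesgue_on Omega)" and w: "square_integrable w"
    and bound: "\<And>n. AE x in lebesgue_on Omega. \<bar>f n x\<bar> \<le> w x"
    and lim: "AE x in lebesgue_on Omega. (\<lambda>n. f n x) \<longlonglongrightarrow> g x"
  shows "(\<lambda>n. L2 (f n)) \<longlonglongrightarrow> L2 g"
proof -
  have all: "AE x in lebesgue_on Omega. \<forall>n. \<bar>f n x\<bar> \<le> w x"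
    using bound by (simp add: AE_all_countable)
  have bg: "AE x in lebesgue_on Omega. \<bar>g x\<bar> \<le> w x"
    using all lim
  proof eventually_elim
    case (elim x)
    then show ?case
      by (intro LIMSEQ_le_const2[OF tendsto_rabs[OF elim(2)]]) auto
  qed
  have sf: "square_integrable (f n)" for n
    by (rule square_integrable_dominated[OF f w]) (use bound[of n] in eventually_elim, auto)
  have sg: "square_integrable g"
    by (rule square_integrable_dominated[OF g w]) (use bg in eventually_elim, auto)
  have "(\<lambda>n. LINT x|lebesgue_on Omega. (f n x - g x)\<^sup>2) \<longlonglongrightarrow> (LINT x|lebesgue_on Omega. 0)"
  proof (rule integral_dominated_convergence)
    show "integrable (lebesgue_on Omega) (\<lambda>x. (2 * w x)\<^sup>2)"
      using square_integrable_scale[OF w, of 2] by (simp add: square_integrable_def)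
    show "AE x in lebesgue_on Omega. (\<lambda>n. (f n x - g x)\<^sup>2) \<longlonglongrightarrow> 0"
      using lim by eventually_elim (auto intro!: tendsto_eq_intros)
    show "AE x in lebesgue_on Omega. norm ((f n x - g x)\<^sup>2) \<le> (2 * w x)\<^sup>2" for n
      using bound[of n] bg
    proof eventually_elim
      case (elim x)
      then have "\<bar>f n x - g x\<bar> \<le> \<bar>2 * w x\<bar>" by linarith
      then show ?case by (simp only: abs_le_square_iff) simp
    qed
  qed (use f g in auto)
  then have "(\<lambda>n. (norm (L2 (f n) - L2 g))\<^sup>2) \<longlonglongrightarrow> 0"
    by (simp add: L2_diff sf sg norm_L2_power2 square_integrable_diff)
  then have "(\<lambda>n. norm (L2 (f n) - L2 g)) \<longlonglongrightarrow> 0"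
    using tendsto_real_sqrt by force
  then show ?thesis
    by (simp add: LIM_zero_iff tendsto_norm_zero_iff)
qed

lemma nn_integral_abs_le_norm_L2:
  assumes "square_integrable f"
  shows "(\<integral>\<^sup>+x. ennreal \<bar>f x\<bar> \<partial>lebesgue_on Omega) \<le> ennreal (norm (L2 (\<lambda>x. 1)) * norm (L2 f))"
proof -
  have sa: "square_integrable (\<lambda>x. \<bar>f x\<bar>)"
    using assms by (auto simp: square_integrable_def)
  have int: "integrable (lebesgue_on Omega) (\<lambda>x. \<bar>f x\<bar>)"
    using square_integrable_mult[OF sa square_integrable_const[of 1]] by simp
  have "norm (L2 (\<lambda>x. \<bar>f x\<bar>)) = norm (L2 f)"
    using norm_L2_power2[OF sa] norm_L2_power2[OF assms]
    by - (rule power2_eq_imp_eq, simp_all)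
  moreover have "(LINT x|lebesgue_on Omega. \<bar>f x\<bar>) = inner (L2 (\<lambda>x. 1)) (L2 (\<lambda>x. \<bar>f x\<bar>))"
    by (simp add: inner_L2 sa)
  ultimately have "(LINT x|lebesgue_on Omega. \<bar>f x\<bar>) \<le> norm (L2 (\<lambda>x. 1)) * norm (L2 f)"
    using norm_cauchy_schwarz[of "L2 (\<lambda>x. 1)" "L2 (\<lambda>x. \<bar>f x\<bar>)"] by simp
  then show ?thesis
    using int by (simp add: nn_integral_eq_integral ennreal_leI)
qed

subsection \<open>Completeness and separability\<close>

text \<open>These instances make the library's Bochner integral available for \<open>L2\<close>-valued functions.\<close>

instance L2 :: complete_space
proof
  fix X :: "nat \<Rightarrow> L2" assume X: "Cauchy X"
  have "\<exists>N. \<forall>m\<ge>N. \<forall>n\<ge>N. dist (X m) (X n) < (1/2) ^ k" for k :: nat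
    using X by (auto simp: Cauchy_def)
  then obtain N where N: "\<And>k m n. m \<ge> N k \<Longrightarrow> n \<ge> N k \<Longrightarrow> dist (X m) (X n) < (1/2) ^ k"
    by metis
  define r where "r k = k + (\<Sum>i\<le>k. N i)" for k
  have r: "strict_mono r"
    by (rule strict_monoI_Suc) (simp add: r_def)
  have rN: "N k \<le> r k" for k
    unfolding r_def by (rule trans_le_add2, rule member_le_sum) auto
  have rmono: "r k \<le> r m" if "k \<le> m" for k m
    using r that by (simp add: strict_mono_less_eq)
  define f where "f k = rep_L2 (X (r k))" for k
  have f: "square_integrable (f k)" "L2 (f k) = X (r k)" for k
    by (auto simp: f_def)
  have [measurable]: "f k \<in> borel_measurable (lebesgue_on Omega)" for k
    using f by (simp add: square_integrable_def)
  let ?C = "norm (L2 (\<lambda>x. 1))"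
  have "(\<integral>\<^sup>+x. (\<Sum>k. ennreal \<bar>f (Suc k) x - f k x\<bar>) \<partial>lebesgue_on Omega)
      = (\<Sum>k. \<integral>\<^sup>+x. ennreal \<bar>f (Suc k) x - f k x\<bar> \<partial>lebesgue_on Omega)"
    by (rule nn_integral_suminf) measurable
  also have "\<dots> \<le> (\<Sum>k. ennreal (?C * (1/2) ^ k))"
  proof (intro suminf_le allI)
    fix k
    have "norm (L2 (\<lambda>x. f (Suc k) x - f k x)) \<le> (1/2) ^ k"
      using N[of k "r (Suc k)" "r k"] rN[of k] rmono[of k "Suc k"]
      by (simp add: L2_diff[symmetric] f dist_norm)
    then have "?C * norm (L2 (\<lambda>x. f (Suc k) x - f k x)) \<le> ?C * (1/2) ^ k"
      by (rule mult_left_mono) simp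
    then show "(\<integral>\<^sup>+x. ennreal \<bar>f (Suc k) x - f k x\<bar> \<partial>lebesgue_on Omega) \<le> ennreal (?C * (1/2) ^ k)"
      using nn_integral_abs_le_norm_L2[OF square_integrable_diff[OF f(1)[of "Suc k"] f(1)[of k]]]
      by (meson ennreal_leI order_trans)
  qed auto
  also have "\<dots> < \<infinity>"
    by (subst suminf_ennreal2) (auto intro!: summable_mult)
  finally have "AE x in lebesgue_on Omega. (\<Sum>k. ennreal \<bar>f (Suc k) x - f k x\<bar>) \<noteq> \<infinity>"
    by (intro nn_integral_PInf_AE) auto
  then have "AE x in lebesgue_on Omega. convergent (\<lambda>k. f k x)"
  proof eventually_elim
    case (elim x)
    then have "summable (\<lambda>k. \<bar>f (Suc k) x - f k x\<bar>)"
      by (intro summable_suminf_not_top) auto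
    then have "convergent (\<lambda>n. \<Sum>k<n. f (Suc k) x - f k x)"
      using summable_iff_convergent summable_rabs_cancel by blast
    then have "convergent (\<lambda>n. (f n x - f 0 x) + f 0 x)"
      by (intro convergent_add convergent_const) (simp add: sum_lessThan_telescope[of "\<lambda>k. f k x"])
    then show ?case by simp
  qed
  then have lim: "AE x in lebesgue_on Omega. (\<lambda>k. f k x) \<longlonglongrightarrow> lim (\<lambda>k. f k x)"
    by eventually_elim (simp add: convergent_LIMSEQ_iff)
  define F where "F x = lim (\<lambda>k. f k x)" for x
  have [measurable]: "F \<in> borel_measurable (lebesgue_on Omega)"
    unfolding F_def by measurable
  have bound: "(\<integral>\<^sup>+x. ennreal ((F x - f m x)\<^sup>2) \<partial>lebesgue_on Omega) \<le> ennreal (((1/2) ^ k)\<^sup>2)"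
    if "k \<le> m" for k m
  proof -
    have "(\<integral>\<^sup>+x. ennreal ((F x - f m x)\<^sup>2) \<partial>lebesgue_on Omega)
        = (\<integral>\<^sup>+x. liminf (\<lambda>n. ennreal ((f n x - f m x)\<^sup>2)) \<partial>lebesgue_on Omega)"
    proof (rule nn_integral_cong_AE, use lim in eventually_elim)
      case (elim x)
      then have "(\<lambda>n. ennreal ((f n x - f m x)\<^sup>2)) \<longlonglongrightarrow> ennreal ((F x - f m x)\<^sup>2)"
        unfolding F_def by (intro tendsto_intros tendsto_ennrealI)
      from lim_imp_Liminf[OF _ this] show ?case by simp
    qed
    also have "\<dots> \<le> liminf (\<lambda>n. \<integral>\<^sup>+x. ennreal ((f n x - f m x)\<^sup>2) \<partial>lebesgue_on Omega)"
      by (rule nn_integral_liminf) measurable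
    also have "\<dots> = liminf (\<lambda>n. ennreal ((norm (X (r n) - X (r m)))\<^sup>2))"
      by (simp add: norm_L2_power2_nn square_integrable_diff f L2_diff[symmetric])
    also have "\<dots> \<le> liminf (\<lambda>n. ennreal (((1/2) ^ k)\<^sup>2))"
    proof (rule Liminf_mono, rule eventually_sequentiallyI)
      fix n assume "k \<le> n"
      then have "norm (X (r n) - X (r m)) \<le> (1/2) ^ k"
        using N[of k "r n" "r m"] rN[of k] rmono[of k n] rmono[of k m] that
        by (simp add: dist_norm)
      then show "ennreal ((norm (X (r n) - X (r m)))\<^sup>2) \<le> ennreal (((1/2) ^ k)\<^sup>2)"
        by (intro ennreal_leI power_mono) auto
    qed
    also have "\<dots> = ennreal (((1/2) ^ k)\<^sup>2)"
      by (simp add: Liminf_const)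
    finally show ?thesis .
  qed
  have sd: "square_integrable (\<lambda>x. F x - f m x)" for m
    unfolding square_integrable_def
  proof
    show "integrable (lebesgue_on Omega) (\<lambda>x. (F x - f m x)\<^sup>2)"
      using bound[of 0 m] by (intro integrableI_bounded) (auto intro: le_less_trans)
  qed measurable
  have sF: "square_integrable F"
    using square_integrable_add[OF sd[of 0] f(1)[of 0]] by simp
  have near: "dist (X (r m)) (L2 F) \<le> (1/2) ^ m" for m
  proof -
    have "ennreal ((norm (L2 F - X (r m)))\<^sup>2) \<le> ennreal (((1/2) ^ m)\<^sup>2)"
      using bound[of m m] norm_L2_power2_nn[OF sd[of m]]
      by (simp add: L2_diff[OF sF f(1), symmetric] f)
    then have "norm (L2 F - X (r m)) \<le> (1/2) ^ m"
      by (subst (asm) ennreal_le_iff) (auto intro: power2_le_imp_le)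
    then show ?thesis by (simp add: dist_norm norm_minus_commute)
  qed
  have "(\<lambda>m. dist (X (r m)) (L2 F)) \<longlonglongrightarrow> 0"
    by (rule tendsto_sandwich[OF _ _ tendsto_const LIMSEQ_realpow_zero[of "1/2"]]) (auto simp: near)
  then have "(X \<circ> r) \<longlonglongrightarrow> L2 F"
    by (subst tendsto_dist_iff) (simp add: o_def)
  then have "X \<longlonglongrightarrow> L2 F"
    using Cauchy_converges_subseq[OF X r] by blast
  then show "convergent X"
    by (auto simp: convergent_def)
qed

instance L2 :: banach ..

definition rat_poly :: "rat list \<Rightarrow> real \<Rightarrow> real" where
  "rat_poly as = (\<lambda>x. \<Sum>i<length as. of_rat (as ! i) * x ^ i)"

lemma continuous_borel_measurable_Omega:
  fixes f :: "real \<Rightarrow> real"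
  assumes "continuous_on UNIV f"
  shows "f \<in> borel_measurable (lebesgue_on Omega)"
  using assms by (intro continuous_imp_measurable_on_sets_lebesgue) (auto intro: continuous_on_subset)

lemma L2_polynomial_in_closure:
  "L2 (\<lambda>x. \<Sum>i\<le>n. a i * x ^ i) \<in> closure (range (\<lambda>as. L2 (rat_poly as)))"
proof -
  have "\<exists>q. \<bar>of_rat q - a i\<bar> < inverse (real (Suc k))" for i k
  proof -
    obtain s where "s \<in> \<rat>" and s: "a i < s" "s < a i + inverse (real (Suc k))"
      using Rats_dense_in_real[of "a i" "a i + inverse (real (Suc k))"] by auto
    from \<open>s \<in> \<rat>\<close> obtain p where p: "s = of_rat p"
      by (rule Rats_cases)
    have "\<bar>s - a i\<bar> < inverse (real (Suc k))"
      unfolding abs_less_iff using s by linarith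
    then show ?thesis
      unfolding p by (rule exI)
  qed
  then obtain q where q: "\<And>i k. \<bar>of_rat (q i k) - a i\<bar> < inverse (real (Suc k))"
    by metis
  have qlim: "(\<lambda>k. of_rat (q i k)) \<longlonglongrightarrow> a i" for i
  proof (rule LIM_zero_cancel, rule tendsto_rabs_zero_cancel)
    show "(\<lambda>k. \<bar>of_rat (q i k) - a i\<bar>) \<longlonglongrightarrow> 0"
      by (rule tendsto_sandwich[OF _ _ tendsto_const LIMSEQ_inverse_real_of_nat])
        (use q in \<open>auto intro!: always_eventually less_imp_le\<close>)
  qed
  define as where "as k = map (\<lambda>i. q i k) [0..<Suc n]" for k
  have rp: "rat_poly (as k) = (\<lambda>x. \<Sum>i\<le>n. of_rat (q i k) * x ^ i)" for k
    unfolding rat_poly_def as_def lessThan_Suc_atMost[symmetric]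
    by (auto intro!: sum.cong simp del: upt_Suc)
  have "(\<lambda>k. L2 (rat_poly (as k))) \<longlonglongrightarrow> L2 (\<lambda>x. \<Sum>i\<le>n. a i * x ^ i)"
  proof (rule L2_tendsto_dominated)
    show "rat_poly (as k) \<in> borel_measurable (lebesgue_on Omega)" for k
      unfolding rp by (intro continuous_borel_measurable_Omega continuous_intros)
    show "(\<lambda>x. \<Sum>i\<le>n. a i * x ^ i) \<in> borel_measurable (lebesgue_on Omega)"
      by (intro continuous_borel_measurable_Omega continuous_intros)
    show "square_integrable (\<lambda>x. \<Sum>i\<le>n. \<bar>a i\<bar> + 1)" by simp
    show "AE x in lebesgue_on Omega. \<bar>rat_poly (as k) x\<bar> \<le> (\<Sum>i\<le>n. \<bar>a i\<bar> + 1)" for k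
    proof (rule AE_I2)
      fix x assume "x \<in> space (lebesgue_on Omega)"
      then have x: "\<bar>x\<bar> \<le> 1" by auto
      have "\<bar>of_rat (q i k) * x ^ i\<bar> \<le> \<bar>a i\<bar> + 1" for i
      proof -
        have "inverse (real (Suc k)) \<le> 1" by (simp add: field_simps)
        then have "\<bar>of_rat (q i k)\<bar> \<le> \<bar>a i\<bar> + 1"
          using q[of i k] by linarith
        moreover have "\<bar>x ^ i\<bar> \<le> 1"
          using x by (simp add: power_abs power_le_one)
        ultimately have "\<bar>of_rat (q i k)\<bar> * \<bar>x ^ i\<bar> \<le> (\<bar>a i\<bar> + 1) * 1"
          by (intro mult_mono) auto
        then show ?thesis by (simp add: abs_mult)
      qed
      then show "\<bar>rat_poly (as k) x\<bar> \<le> (\<Sum>i\<le>n. \<bar>a i\<bar> + 1)"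
        unfolding rp by (intro order_trans[OF sum_abs] sum_mono)
    qed
    show "AE x in lebesgue_on Omega. (\<lambda>k. rat_poly (as k) x) \<longlonglongrightarrow> (\<Sum>i\<le>n. a i * x ^ i)"
      unfolding rp by (intro AE_I2 tendsto_intros qlim)
  qed
  then show ?thesis
    by (rule closed_sequentially[OF closed_closure subsetD[OF closure_subset rangeI]])
qed

lemma L2_continuous_in_closure:
  fixes f :: "real \<Rightarrow> real"
  assumes f: "continuous_on UNIV f"
  shows "L2 f \<in> closure (range (\<lambda>as. L2 (rat_poly as)))"
proof -
  have fI: "continuous_on {-1..1} f"
    using f by (rule continuous_on_subset) simp
  have "\<exists>g. real_polynomial_function g \<and> (\<forall>x\<in>{-1..1}. \<bar>f x - g x\<bar> < inverse (real (Suc k)))" for k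
    using Stone_Weierstrass_real_polynomial_function[OF compact_Icc fI, of "inverse (real (Suc k))"]
    by (metis inverse_positive_iff_positive of_nat_0_less_iff zero_less_Suc)
  then obtain g where g: "\<And>k. real_polynomial_function (g k)"
    "\<And>k x. x \<in> {-1..1} \<Longrightarrow> \<bar>f x - g k x\<bar> < inverse (real (Suc k))"
    by metis
  obtain B where B: "\<And>x. x \<in> {-1..1} \<Longrightarrow> \<bar>f x\<bar> \<le> B"
    using compact_imp_bounded[OF compact_continuous_image[OF fI compact_Icc]]
    unfolding bounded_real by (metis imageI)
  have gcl: "L2 (g k) \<in> closure (range (\<lambda>as. L2 (rat_poly as)))" for k
    using g(1)[of k] L2_polynomial_in_closure by (auto simp: real_polynomial_function_iff_sum)
  have "(\<lambda>k. L2 (g k)) \<longlonglongrightarrow> L2 f"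
  proof (rule L2_tendsto_dominated)
    show "g k \<in> borel_measurable (lebesgue_on Omega)" for k
      using g(1)[of k]
      by (auto simp: real_polynomial_function_iff_sum
          intro!: continuous_borel_measurable_Omega continuous_intros)
    show "f \<in> borel_measurable (lebesgue_on Omega)"
      by (rule continuous_borel_measurable_Omega[OF f])
    show "square_integrable (\<lambda>x. B + 1)" by simp
    show "AE x in lebesgue_on Omega. \<bar>g k x\<bar> \<le> B + 1" for k
    proof (rule AE_I2)
      fix x assume "x \<in> space (lebesgue_on Omega)"
      then have x: "x \<in> {-1..1}" by auto
      have "inverse (real (Suc k)) \<le> 1" by (simp add: field_simps)
      then show "\<bar>g k x\<bar> \<le> B + 1"
        using g(2)[OF x, of k] B[OF x] by linarith
    qed
    show "AE x in lebesgue_on Omega. (\<lambda>k. g k x) \<longlonglongrightarrow> f x"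
    proof (rule AE_I2)
      fix x assume "x \<in> space (lebesgue_on Omega)"
      then have x: "x \<in> {-1..1}" by auto
      have less: "\<bar>g k x - f x\<bar> \<le> inverse (real (Suc k))" for k
        using g(2)[OF x, of k] by linarith
      have "(\<lambda>k. \<bar>g k x - f x\<bar>) \<longlonglongrightarrow> 0"
        by (rule tendsto_sandwich[OF _ _ tendsto_const LIMSEQ_inverse_real_of_nat])
          (use less in simp_all)
      then show "(\<lambda>k. g k x) \<longlonglongrightarrow> f x"
        by (rule LIM_zero_cancel[OF tendsto_rabs_zero_cancel])
    qed
  qed
  then show ?thesis
    by (rule closed_sequentially[OF closed_closure gcl])
qed

lemma rat_poly_dense: "L2 f \<in> closure (range (\<lambda>as. L2 (rat_poly as)))"
  if sf: "square_integrable f"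
proof -
  have [measurable]: "f \<in> borel_measurable (lebesgue_on Omega)"
    using sf by (simp add: square_integrable_def)
  define clip where "clip n y = max (- real n) (min (real n) y)" for n and y :: real
  have clip: "\<bar>clip n y\<bar> \<le> real n" "\<bar>clip n y\<bar> \<le> \<bar>y\<bar>" for n y
    by (auto simp: clip_def)
  have clip_cont: "continuous_on S g \<Longrightarrow> continuous_on S (\<lambda>x. clip n (g x))"
    for S :: "real set" and g n
    unfolding clip_def by (intro continuous_intros)
  have clip_meas: "(\<lambda>x. clip n (f x)) \<in> borel_measurable (lebesgue_on Omega)" for n
    unfolding clip_def by measurable
  have "f measurable_on Omega"
    by (simp add: measurable_on_iff_borel_measurable)
  then obtain E g where E: "negligible E" and g: "\<And>n. continuous_on UNIV (g n)"
    and glim: "\<And>x. x \<notin> E \<Longrightarrow> (\<lambda>n. g n x) \<longlonglongrightarrow> (if x \<in> Omega then f x else 0)"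
    unfolding measurable_on_def by blast
  have AE_E: "AE x in lebesgue_on Omega. x \<notin> E"
    using E by (subst AE_restrict_space_iff)
      (auto simp: negligible_iff_null_sets dest!: AE_not_in)
  have bounded: "L2 (\<lambda>x. clip n (f x)) \<in> closure (range (\<lambda>as. L2 (rat_poly as)))" for n
  proof (rule closed_sequentially[OF closed_closure])
    show "L2 (\<lambda>x. clip n (g k x)) \<in> closure (range (\<lambda>as. L2 (rat_poly as)))" for k
      by (intro L2_continuous_in_closure clip_cont g)
    show "(\<lambda>k. L2 (\<lambda>x. clip n (g k x))) \<longlonglongrightarrow> L2 (\<lambda>x. clip n (f x))"
    proof (rule L2_tendsto_dominated)
      show "(\<lambda>x. clip n (g k x)) \<in> borel_measurable (lebesgue_on Omega)" for k
        by (intro continuous_borel_measurable_Omega clip_cont g)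
      show "square_integrable (\<lambda>x. real n)" by simp
      show "AE x in lebesgue_on Omega. \<bar>clip n (g k x)\<bar> \<le> real n" for k
        using clip by simp
      show "AE x in lebesgue_on Omega. (\<lambda>k. clip n (g k x)) \<longlonglongrightarrow> clip n (f x)"
        using AE_E AE_space
      proof eventually_elim
        case (elim x)
        then have "(\<lambda>k. g k x) \<longlonglongrightarrow> f x"
          using glim[of x] by simp
        then show ?case
          unfolding clip_def by (intro tendsto_intros)
      qed
    qed (rule clip_meas)
  qed
  show ?thesis
  proof (rule closed_sequentially[OF closed_closure bounded])
    show "(\<lambda>n. L2 (\<lambda>x. clip n (f x))) \<longlonglongrightarrow> L2 f"
    proof (rule L2_tendsto_dominated[OF clip_meas])
      show "square_integrable (\<lambda>x. \<bar>f x\<bar>)"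
        using sf by (auto simp: square_integrable_def)
      show "AE x in lebesgue_on Omega. (\<lambda>n. clip n (f x)) \<longlonglongrightarrow> f x"
      proof (rule AE_I2)
        fix x
        have "\<forall>\<^sub>F n in sequentially. clip n (f x) = f x"
          using eventually_ge_at_top[of "nat \<lceil>\<bar>f x\<bar>\<rceil>"]
          by eventually_elim (auto simp: clip_def)
        then show "(\<lambda>n. clip n (f x)) \<longlonglongrightarrow> f x"
          by (rule tendsto_eventually)
      qed
    qed (use clip in auto)
  qed
qed

instance L2 :: second_countable_topology
proof
  let ?D = "range (\<lambda>as. L2 (rat_poly as))"
  let ?B = "(\<lambda>(d, n). ball d (inverse (real (Suc n)))) ` (?D \<times> UNIV)"
  have "topological_basis ?B"
  proof (rule topological_basisI)
    fix U :: "L2 set" and x assume U: "open U" "x \<in> U"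
    then obtain e where e: "e > 0" "ball x e \<subseteq> U"
      using open_contains_ball by blast
    obtain n where n: "inverse (real (Suc n)) < e / 2"
      using reals_Archimedean[of "e/2"] e by auto
    have "x \<in> closure ?D"
      using rat_poly_dense[OF square_integrable_rep[of x]] by simp
    then obtain d where d: "d \<in> ?D" "dist d x < inverse (real (Suc n))"
      by (meson closure_approachable inverse_positive_iff_positive of_nat_0_less_iff zero_less_Suc)
    have "ball d (inverse (real (Suc n))) \<subseteq> ball x e"
    proof
      fix z assume "z \<in> ball d (inverse (real (Suc n)))"
      then show "z \<in> ball x e"
        using d(2) n dist_triangle[of x z d] by (simp add: dist_commute)
    qed
    then show "\<exists>B'\<in>?B. x \<in> B' \<and> B' \<subseteq> U"
      using d e by (intro bexI[of _ "ball d (inverse (real (Suc n)))"]) auto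
  qed auto
  moreover have "countable ?B"
    by (intro countable_image countable_SIGMA) auto
  ultimately show "\<exists>B::L2 set set. countable B \<and> open = generate_topology B"
    using topological_basis_imp_subbasis by blast
qed


section \<open>Sobolev spaces on intervals\<close>

text \<open>\<open>C1c a b\<close>: the continuously differentiable functions with compact support in (a,b).\<close>

definition C1c :: "real \<Rightarrow> real \<Rightarrow> (real \<Rightarrow> real) set" where
  "C1c a b = {\<phi>. \<phi> C1_differentiable_on UNIV \<and>
     (\<exists>c d. a < c \<and> d < b \<and> (\<forall>x. x \<notin> {c..d} \<longrightarrow> \<phi> x = 0))}"

text \<open>
  The integrals are Bochner integrals. The library's integral is 0 for non-integrable
  functions, so this is only used for \<open>u\<close> and \<open>v\<close> integrable on (a,b).
\<close>

definition has_weak_derivative ::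
    "real \<Rightarrow> real \<Rightarrow> (real \<Rightarrow> 'a::{banach, second_countable_topology}) \<Rightarrow> (real \<Rightarrow> 'a) \<Rightarrow> bool" where
  "has_weak_derivative a b u v \<longleftrightarrow> (\<forall>\<phi>\<in>C1c a b.
     (LINT t|lebesgue_on {a<..<b}. deriv \<phi> t *\<^sub>R u t) =
     - (LINT t|lebesgue_on {a<..<b}. \<phi> t *\<^sub>R v t))"

definition L_infinity :: "real set \<Rightarrow> (real \<Rightarrow> 'a::{banach, second_countable_topology}) set" where
  "L_infinity J = {v. v \<in> borel_measurable (lebesgue_on J) \<and>
     (\<exists>M. AE t in lebesgue_on J. norm (v t) \<le> M)}"

text \<open>
  \<open>W1_inf a b u v\<close>: \<open>u\<close> is the continuous representative of an element of the Bochner-Sobolev space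
  \<open>W\<^sup>1\<^sup>,\<^sup>\<infinity>([a,b], X)\<close> and \<open>v\<close> is its time derivative, which is determined up to null sets.
  Choosing the continuous representative gives a meaning to the conditions imposed on \<open>u t\<close>
  for every \<open>t\<close>, in particular to initial conditions.
\<close>

definition W1_inf ::
    "real \<Rightarrow> real \<Rightarrow> (real \<Rightarrow> 'a::{banach, second_countable_topology}) \<Rightarrow> (real \<Rightarrow> 'a) \<Rightarrow> bool" where
  "W1_inf a b u v \<longleftrightarrow> continuous_on {a..b} u \<and> u \<in> L_infinity {a..b} \<and> v \<in> L_infinity {a..b} \<and>
     has_weak_derivative a b u v"

definition has_weak_dx :: "L2 \<Rightarrow> L2 \<Rightarrow> bool" where
  "has_weak_dx f f' \<longleftrightarrow> has_weak_derivative (-1) 1 (rep_L2 f) (rep_L2 f')"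

definition W12 :: "L2 set" where
  "W12 = {f. \<exists>f'. has_weak_dx f f'}"

text \<open>
  The closure of the test functions in \<open>W\<^sup>1\<^sup>,\<^sup>2\<close>: the norm of \<open>L2 \<times> L2\<close> at
  \<open>(u, u')\<close> is the \<open>W\<^sup>1\<^sup>,\<^sup>2\<close>-norm of \<open>u\<close>.
\<close>

definition W12_0 :: "L2 set" where
  "W12_0 = {u. \<exists>u'. has_weak_dx u u' \<and>
     (u, u') \<in> closure ((\<lambda>\<phi>. (L2 \<phi>, L2 (deriv \<phi>))) ` C1c (-1) 1)}"

section \<open>The data of the rod\<close>

text \<open>The normal cone is empty at points outside of the set.\<close>

definition normal_cone :: "'a::real_inner set \<Rightarrow> 'a \<Rightarrow> 'a set" where
  "normal_cone C x = {z. x \<in> C \<and> (\<forall>c\<in>C. inner z (c - x) \<le> 0)}"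

abbreviation (input) T_end :: real where "T_end \<equiv> 3"
abbreviation (input) t_star :: real where "t_star \<equiv> 7/3"

definition Sigma_yield :: "L2 set" where
  "Sigma_yield = {\<sigma>. AE x in lebesgue_on Omega. -1 \<le> rep_L2 \<sigma> x \<and> rep_L2 \<sigma> x \<le> 1}"

definition V_space :: "L2 set" where
  "V_space = range (\<lambda>c. L2 (\<lambda>x. c))"

definition U_space :: "L2 set" where
  "U_space = {\<sigma>. (LINT x|lebesgue_on Omega. rep_L2 \<sigma> x) = 0}"

definition body_force :: "real \<Rightarrow> L2" where
  "body_force t = L2 (\<lambda>x. if t < 1 then 2 * x * t else 2 * x)"

definition u_a :: "real \<Rightarrow> real" where "u_a t = 0"

definition u_b :: "real \<Rightarrow> real" where "u_b t = (if t < 1 then 0 else t - 1)"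

definition u_D :: "real \<Rightarrow> real \<Rightarrow> real" where
  "u_D t x = (1 - x) / 2 * u_a t + (x + 1) / 2 * u_b t"

definition g_load :: "real \<Rightarrow> L2" where
  "g_load t = L2 (deriv (u_D t))"

definition sigma_tilde :: "real \<Rightarrow> L2" where
  "sigma_tilde t = L2 (\<lambda>x. if t < 1 then t * (1/3 - x\<^sup>2) else 1/2 * (t - 1) + 1/3 - x\<^sup>2)"

definition y_sol :: "real \<Rightarrow> L2" where
  "y_sol t = L2 (\<lambda>x. if t < t_star then 0 else - (1/2) * (t - t_star))"

text \<open>
  Strong derivative in \<open>L2\<close> relative to the time interval, i.e. one-sided at its end points.
  It is used for the explicitly given \<open>sigma_tilde\<close> and \<open>y_sol\<close>, which are
  piecewise affine in time.
\<close>

definition ddt :: "(real \<Rightarrow> L2) \<Rightarrow> real \<Rightarrow> L2" where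
  "ddt u t = vector_derivative u (at t within {0..T_end})"

definition Sigma_shifted :: "real \<Rightarrow> L2 set" where
  "Sigma_shifted t = {\<sigma> - sigma_tilde t | \<sigma>. \<sigma> \<in> Sigma_yield}"

definition C_moving :: "real \<Rightarrow> L2 set" where
  "C_moving t = Sigma_shifted t \<inter> V_space"

text \<open>\<open>admissible_rates t y y'\<close> is the set \<open>(N\<^bsub>\<Sigma> - \<sigma>(t)\<^esub>(y) + y') \<inter> U\<close>,
  with \<open>\<sigma>\<close> the elastic stress.\<close>

definition admissible_rates :: "real \<Rightarrow> L2 \<Rightarrow> L2 \<Rightarrow> L2 set" where
  "admissible_rates t y y' = {z + y' | z. z \<in> normal_cone (Sigma_shifted t) y} \<inter> U_space"

definition strain_rates :: "real \<Rightarrow> L2 \<Rightarrow> L2 \<Rightarrow> L2 set" where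
  "strain_rates t y y' = {w + ddt sigma_tilde t | w. w \<in> admissible_rates t y y'}"

section \<open>The two evolution problems\<close>

definition sweeping_solution :: "L2 \<Rightarrow> (real \<Rightarrow> L2) \<Rightarrow> (real \<Rightarrow> L2) \<Rightarrow> bool" where
  "sweeping_solution \<epsilon>\<^sub>0 y \<epsilon> \<longleftrightarrow> (\<exists>y' \<epsilon>'.
     W1_inf 0 T_end y y' \<and> W1_inf 0 T_end \<epsilon> \<epsilon>' \<and>
     (AE t in lebesgue_on {0..T_end}.
        - y' t \<in> normal_cone (C_moving t) (y t) \<and>
        \<epsilon>' t \<in> strain_rates t (y t) (y' t)) \<and>
     (\<forall>t\<in>{0..T_end}. y t \<in> C_moving t) \<and>
     y 0 = 0 \<and> \<epsilon> 0 = \<epsilon>\<^sub>0)"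

text \<open>The stiffness is identically 1, so Hooke's law reads \<open>\<sigma> = \<epsilon>\<^sub>e\<^sub>l\<close>.\<close>

definition quasistatic_solution ::
    "L2 \<Rightarrow> (real \<Rightarrow> L2) \<Rightarrow> (real \<Rightarrow> L2) \<Rightarrow> (real \<Rightarrow> L2) \<Rightarrow> (real \<Rightarrow> L2) \<Rightarrow> bool" where
  "quasistatic_solution \<epsilon>\<^sub>0 \<epsilon> \<epsilon>_el \<epsilon>_p \<sigma> \<longleftrightarrow> (\<exists>\<epsilon>' \<epsilon>_el' \<epsilon>_p' \<sigma>'.
     W1_inf 0 T_end \<epsilon> \<epsilon>' \<and> W1_inf 0 T_end \<epsilon>_el \<epsilon>_el' \<and>
     W1_inf 0 T_end \<epsilon>_p \<epsilon>_p' \<and> W1_inf 0 T_end \<sigma> \<sigma>' \<and>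
     (\<forall>t\<in>{0..T_end}.
        (\<exists>u\<in>W12_0. \<exists>u'. has_weak_dx u u' \<and> \<epsilon> t = u' + g_load t) \<and>
        \<epsilon> t = \<epsilon>_el t + \<epsilon>_p t \<and>
        \<sigma> t = \<epsilon>_el t \<and>
        \<sigma> t \<in> W12 \<and> (\<exists>s. has_weak_dx (\<sigma> t) s \<and> - s = body_force t)) \<and>
     (AE t in lebesgue_on {0..T_end}. \<epsilon>_p' t \<in> normal_cone Sigma_yield (\<sigma> t)) \<and>
     \<sigma> 0 = 0 \<and> \<epsilon>_el 0 = 0 \<and> \<epsilon> 0 = \<epsilon>\<^sub>0 \<and> \<epsilon>_p 0 = \<epsilon>\<^sub>0)"

end

(*
  A stress with the prescribed body force has the form k - m x^2 with m = min t 1. For t > 0 such a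
  stress, if it lies in the yield set, attains a yield limit only at finitely many points, so its
  normal cone in L^2 is trivial. Hence in every evolution the plastic strain rate (or, for the
  sweeping process, the part of the strain rate coming from the normal cone) vanishes for almost
  every t, and the yield set cannot be respected once the prescribed mean elongation forces k > 1,
  that is for t > 7/3. For the sweeping process, the rate y' alone would have to have mean zero, so y
  would stay at 0, and 0 has left the moving set at t = 3.
*)
theory Submission
  imports Defs
begin

section \<open>Test functions\<close>

text \<open>Bridge from the Bochner integral over the open interval to the gauge integral over the
  closed one, for which the fundamental theorem of calculus is stated.\<close>

lemma continuous_lebesgue_on_open_interval:
  fixes f :: "real \<Rightarrow> 'a::euclidean_space"
  assumes "continuous_on {a..b} f"
  shows integrable_continuous_open_interval: "integrable (lebesgue_on {a<..<b}) f"
    and LINT_continuous_open_interval: "(LINT x|lebesgue_on {a<..<b}. f x) = integral {a..b} f"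
proof -
  show int: "integrable (lebesgue_on {a<..<b}) f"
    using continuous_imp_integrable_real[OF assms]
    by (simp add: integrable_restrict_space) (metis greaterThanLessThan_subseteq_atLeastAtMost_iff
        lmeasurable_interval(2) fmeasurableD set_integrable_def set_integrable_subset order_refl)
  show "(LINT x|lebesgue_on {a<..<b}. f x) = integral {a..b} f"
    using lebesgue_integral_eq_integral[OF int] by (simp add: integral_open_interval_real)
qed

lemma C1c_has_deriv:
  assumes "\<phi> \<in> C1c a b"
  shows "(\<phi> has_real_derivative deriv \<phi> x) (at x)"
    and "continuous_on S (deriv \<phi>)" and "continuous_on S \<phi>"
proof -
  obtain D where D: "\<And>x. (\<phi> has_vector_derivative D x) (at x)" "continuous_on UNIV D"
    using assms unfolding C1c_def C1_differentiable_on_def by auto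
  have dD: "(\<phi> has_real_derivative D x) (at x)" for x
    using D(1) by (simp add: has_real_derivative_iff_has_vector_derivative)
  then have "deriv \<phi> = D"
    using DERIV_imp_deriv by blast
  with dD D show "(\<phi> has_real_derivative deriv \<phi> x) (at x)" "continuous_on S (deriv \<phi>)"
    by (auto intro: continuous_on_subset)
  show "continuous_on S \<phi>"
    using dD by (meson DERIV_isCont continuous_at_imp_continuous_on)
qed

lemma C1c_boundary:
  assumes "\<phi> \<in> C1c a b"
  shows "\<phi> a = 0" "\<phi> b = 0"
  using assms by (auto simp: C1c_def)

lemma C1cI:
  assumes "\<And>x. (\<phi> has_real_derivative \<phi>' x) (at x)" "continuous_on UNIV \<phi>'"
    "a < c" "d < b" "\<And>x. x \<notin> {c..d} \<Longrightarrow> \<phi> x = 0"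
  shows "\<phi> \<in> C1c a b"
  using assms unfolding C1c_def C1_differentiable_on_def
  by (auto simp: has_real_derivative_iff_has_vector_derivative)

text \<open>Any primitive of \<open>k\<close> is constant to the left of \<open>c\<close> and to the
  right of \<open>d\<close>. The vanishing integral makes the two constants agree, so subtracting
  the value at \<open>a\<close> yields compact support.\<close>

lemma C1c_primitive:
  fixes k :: "real \<Rightarrow> real"
  assumes k: "continuous_on UNIV k" and "a < b" and cd: "a < c" "d < b"
    and k0: "\<And>x. x \<notin> {c..d} \<Longrightarrow> k x = 0"
    and int: "(LINT x|lebesgue_on {a<..<b}. k x) = 0"
  obtains \<phi> where "\<phi> \<in> C1c a b" "deriv \<phi> = k"
proof -
  obtain F where F: "\<And>x. (F has_vector_derivative k x) (at x)"
    using einterval_antiderivative[of "-\<infinity>" "\<infinity>" k] k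
    by (auto simp: continuous_on_eq_continuous_at)
  then have F': "(F has_real_derivative k x) (at x)" for x
    by (simp add: has_real_derivative_iff_has_vector_derivative)
  have "(k has_integral F b - F a) {a..b}"
    using F \<open>a < b\<close> by (intro fundamental_theorem_of_calculus)
      (auto intro: has_vector_derivative_at_within)
  then have Fab: "F b = F a"
    using int k LINT_continuous_open_interval[of a b k]
    by (simp add: integral_unique continuous_on_subset)
  have left: "F x = F a" if "x < c" for x
  proof -
    have "\<exists>C. \<forall>x\<in>{..<c}. F x = C"
      using F' k0 by (intro has_field_derivative_zero_constant)
        (auto, metis DERIV_subset atLeastAtMost_iff not_le subset_UNIV)
    then show ?thesis
      using that cd by force
  qed
  have right: "F x = F b" if "d < x" for x
  proof -
    have "\<exists>C. \<forall>x\<in>{d<..}. F x = C"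
      using F' k0 by (intro has_field_derivative_zero_constant)
        (auto, metis DERIV_subset atLeastAtMost_iff not_le subset_UNIV)
    then show ?thesis
      using that cd by force
  qed
  have der: "((\<lambda>x. F x - F a) has_real_derivative k x) (at x)" for x
    using DERIV_diff[OF F' DERIV_const] by simp
  show thesis
  proof (rule that)
    show "(\<lambda>x. F x - F a) \<in> C1c a b"
      using der k cd by (rule C1cI) (use left right Fab in force)
    show "deriv (\<lambda>x. F x - F a) = k"
      using der DERIV_imp_deriv by blast
  qed
qed

section \<open>Continuously differentiable cutoff functions\<close>

lemma DERIV_pos_part_power2:
  "((\<lambda>s::real. (max 0 s)\<^sup>2) has_real_derivative 2 * max 0 s) (at s)"
proof -
  consider "s > 0" | "s < 0" | "s = 0" by linarith
  then show ?thesis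
  proof cases
    case 1
    have "((\<lambda>s. s\<^sup>2) has_real_derivative 2 * max 0 s) (at s)"
      using 1 by (auto intro!: derivative_eq_intros)
    then show ?thesis
      using 1 by (rule has_field_derivative_transform_within[where d = s])
        (auto simp: dist_real_def max_def)
  next
    case 2
    have "((\<lambda>s. 0) has_real_derivative 2 * max 0 s) (at s)"
      using 2 by auto
    then show ?thesis
      by (rule has_field_derivative_transform_within[where d = "-s"])
        (use 2 in \<open>auto simp: dist_real_def max_def\<close>)
  next
    case 3
    have "(\<lambda>h. (max 0 h)\<^sup>2 / h) \<midarrow>0\<rightarrow> (0::real)"
    proof (rule Lim_null_comparison)
      show "\<forall>\<^sub>F h in at 0. norm ((max 0 h)\<^sup>2 / h) \<le> \<bar>h::real\<bar>"
        by (rule always_eventually) (auto simp: max_def power2_eq_square)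
      show "(\<lambda>h. \<bar>h::real\<bar>) \<midarrow>0\<rightarrow> 0"
        using tendsto_rabs_zero[OF tendsto_ident_at] by simp
    qed
    then show ?thesis
      using 3 by (simp add: DERIV_def)
  qed
qed

text \<open>The construction composes squared positive parts, which are continuously differentiable:
  \<open>\<kappa> n\<close> is 0 where \<open>s n\<close> is at most 0 and 1 where
  \<open>s n\<close> is at least 1. The quadratic in \<open>s n\<close> vanishes at both end points
  and its factor grows with \<open>n\<close>, so the region where \<open>\<kappa> n\<close> is 1
  exhausts the interval.\<close>

lemma C1c_cutoff:
  fixes a b :: real
  assumes "a < b"
  obtains \<kappa> :: "nat \<Rightarrow> real \<Rightarrow> real" where
    "\<And>n. \<kappa> n \<in> C1c a b" "\<And>n x. \<bar>\<kappa> n x\<bar> \<le> 1"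
    "\<And>x. x \<in> {a<..<b} \<Longrightarrow> (\<lambda>n. \<kappa> n x) \<longlonglongrightarrow> 1"
proof -
  define s where "s n x = real (Suc n) * ((x - a) * (b - x)) - 1" for n x
  define \<kappa> where "\<kappa> n x = 1 - (max 0 (1 - (max 0 (s n x))\<^sup>2))\<^sup>2" for n x
  let ?d = "\<lambda>n x. 2 * max 0 (1 - (max 0 (s n x))\<^sup>2) * (2 * max 0 (s n x) * (real (Suc n) * (b - x - (x - a))))"
  have ds: "(s n has_real_derivative real (Suc n) * (b - x - (x - a))) (at x)" for n x
    unfolding s_def by (auto intro!: derivative_eq_intros simp: algebra_simps)
  have d1: "((\<lambda>x. 1 - (max 0 (s n x))\<^sup>2) has_real_derivative - (2 * max 0 (s n x) * (real (Suc n) * (b - x - (x - a))))) (at x)" for n x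
    using DERIV_diff[OF DERIV_const[of 1] DERIV_chain2[OF DERIV_pos_part_power2 ds]] by simp
  have d\<kappa>: "(\<kappa> n has_real_derivative ?d n x) (at x)" for n x
    unfolding \<kappa>_def
    using DERIV_diff[OF DERIV_const[of 1] DERIV_chain2[OF DERIV_pos_part_power2 d1]] by simp
  have sc: "continuous_on UNIV (s n)" for n
    using ds by (meson DERIV_isCont continuous_at_imp_continuous_on)
  show thesis
  proof
    show "\<kappa> n \<in> C1c a b" for n
    proof (rule C1cI[OF d\<kappa>])
      show "continuous_on UNIV (?d n)"
        by (intro continuous_intros sc)
      \<comment> \<open>Where \<open>s n\<close> is positive, the product of the distances to
        \<open>a\<close> and \<open>b\<close> exceeds \<open>1 / real (Suc n)\<close>. Each distance
        is at most \<open>b - a\<close>, so the other one exceeds \<open>?e\<close>.\<close>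
      let ?e = "1 / (real (Suc n) * (b - a))"
      show "a < a + ?e" "b - ?e < b"
        using assms by auto
      fix x assume x: "x \<notin> {a + ?e..b - ?e}"
      have "s n x \<le> 0"
      proof (rule ccontr)
        assume "\<not> s n x \<le> 0"
        then have p: "real (Suc n) * ((x - a) * (b - x)) > 1"
          by (simp add: s_def)
        then have "(x - a) * (b - x) > 0"
          by (metis less_trans of_nat_0_less_iff zero_less_Suc zero_less_mult_pos zero_less_one)
        then have ab: "a < x" "x < b"
          using assms by (auto simp: zero_less_mult_iff)
        have "real (Suc n) * ((x - a) * (b - x)) \<le> real (Suc n) * ((x - a) * (b - a))"
          using ab by (intro mult_left_mono) auto
        then have "real (Suc n) * (b - a) * (x - a) > 1"
          using p by (simp add: mult_ac)
        then have 1: "x - a > ?e"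
          using assms pos_divide_less_eq[of "real (Suc n) * (b - a)" 1 "x - a"] by (simp add: mult.commute)
        have "real (Suc n) * ((x - a) * (b - x)) \<le> real (Suc n) * ((b - a) * (b - x))"
          using ab by (intro mult_left_mono mult_right_mono) auto
        then have "real (Suc n) * (b - a) * (b - x) > 1"
          using p by (simp add: mult_ac)
        then have "b - x > ?e"
          using assms pos_divide_less_eq[of "real (Suc n) * (b - a)" 1 "b - x"] by (simp add: mult.commute)
        with 1 x show False by auto
      qed
      then show "\<kappa> n x = 0"
        by (simp add: \<kappa>_def max_absorb1)
    qed
    show "\<bar>\<kappa> n x\<bar> \<le> 1" for n x
    proof -
      have "(max 0 (1 - (max 0 (s n x))\<^sup>2))\<^sup>2 \<le> 1\<^sup>2"
        by (rule power_mono) auto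
      then show ?thesis
        by (simp add: \<kappa>_def)
    qed
    fix x assume x: "x \<in> {a<..<b}"
    then have p: "0 < (x - a) * (b - x)" by simp
    \<comment> \<open>The bound is 2 rather than 1 because \<open>s\<close> subtracts 1 and must
      still reach 1.\<close>
    obtain N where N: "real N * ((x - a) * (b - x)) > 2"
      using ex_less_of_nat_mult[OF p] by blast
    have "\<forall>\<^sub>F n in sequentially. \<kappa> n x = 1"
    proof (rule eventually_sequentiallyI)
      fix n assume "N \<le> n"
      then have "real N * ((x - a) * (b - x)) \<le> real (Suc n) * ((x - a) * (b - x))"
        using p by (intro mult_right_mono) auto
      then have "1 \<le> s n x"
        using N by (simp add: s_def)
      then have "1\<^sup>2 \<le> (max 0 (s n x))\<^sup>2"
        by (intro power_mono) auto
      then show "\<kappa> n x = 1"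
        by (simp add: \<kappa>_def max_absorb1)
    qed
    then show "(\<lambda>n. \<kappa> n x) \<longlonglongrightarrow> 1"
      by (rule tendsto_eventually)
  qed
qed

lemma C1c_support:
  assumes "\<phi> \<in> C1c a b"
  obtains c d where "a < c" "d < b" "\<And>x. x \<notin> {c..d} \<Longrightarrow> \<phi> x = 0"
  using assms by (auto simp: C1c_def)

lemma C1c_measurable:
  assumes "\<phi> \<in> C1c a b" "S \<in> sets lebesgue"
  shows "\<phi> \<in> borel_measurable (lebesgue_on S)"
  using C1c_has_deriv(3)[OF assms(1)] assms(2) by (auto intro: continuous_imp_measurable_on_sets_lebesgue)

lemma cutoff_integral_tendsto:
  fixes g :: "real \<Rightarrow> real"
  assumes g: "integrable (lebesgue_on {a<..<b}) g"
    and \<kappa>: "\<And>n. \<kappa> n \<in> C1c a b" "\<And>n x. \<bar>\<kappa> n x\<bar> \<le> 1"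
      "\<And>x. x \<in> {a<..<b} \<Longrightarrow> (\<lambda>n. \<kappa> n x) \<longlonglongrightarrow> 1"
  shows "(\<lambda>n. LINT x|lebesgue_on {a<..<b}. \<kappa> n x * g x) \<longlonglongrightarrow> (LINT x|lebesgue_on {a<..<b}. g x)"
proof (rule integral_dominated_convergence)
  show "integrable (lebesgue_on {a<..<b}) (\<lambda>x. \<bar>g x\<bar>)"
    using g by simp
  show "AE x in lebesgue_on {a<..<b}. (\<lambda>n. \<kappa> n x * g x) \<longlonglongrightarrow> g x"
  proof (rule AE_I2)
    fix x assume "x \<in> space (lebesgue_on {a<..<b})"
    then show "(\<lambda>n. \<kappa> n x * g x) \<longlonglongrightarrow> g x"
      using tendsto_mult_right[OF \<kappa>(3), of x "g x"] by simp
  qed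
  show "AE x in lebesgue_on {a<..<b}. norm (\<kappa> n x * g x) \<le> \<bar>g x\<bar>" for n
    using \<kappa>(2) by (intro AE_I2) (simp add: abs_mult mult_left_le_one_le)
  show "(\<lambda>x. \<kappa> n x * g x) \<in> borel_measurable (lebesgue_on {a<..<b})" for n
    using C1c_measurable[OF \<kappa>(1)[of n]] g by (intro borel_measurable_times) auto
qed (use g in auto)

text \<open>The constant 1 is not a test function, but the cutoffs are, and they converge to it
  boundedly.\<close>

lemma integral_eq_0_of_orthogonal_C1c:
  fixes w :: "real \<Rightarrow> real"
  assumes "a < b" "integrable (lebesgue_on {a<..<b}) w"
    and "\<And>\<phi>. \<phi> \<in> C1c a b \<Longrightarrow> (LINT x|lebesgue_on {a<..<b}. \<phi> x * w x) = 0"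
  shows "(LINT x|lebesgue_on {a<..<b}. w x) = 0"
proof -
  obtain \<kappa> :: "nat \<Rightarrow> real \<Rightarrow> real" where \<kappa>:
    "\<And>n. \<kappa> n \<in> C1c a b" "\<And>n x. \<bar>\<kappa> n x\<bar> \<le> 1"
    "\<And>x. x \<in> {a<..<b} \<Longrightarrow> (\<lambda>n. \<kappa> n x) \<longlonglongrightarrow> 1"
    using C1c_cutoff[OF \<open>a < b\<close>] by blast
  from cutoff_integral_tendsto[OF assms(2) \<kappa>] assms(3)[OF \<kappa>(1)] show ?thesis
    by (simp add: LIMSEQ_const_iff)
qed

section \<open>The lemma of du Bois-Reymond\<close>

text \<open>The conclusion says that \<open>u\<close>, tested with \<open>h\<close>, acts like its
  mean value. This form serves both the pointwise version for continuous functions and the version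
  in \<open>L2\<close>. The identity is first shown with \<open>\<kappa> n\<close> as a weight, and
  then \<open>n\<close> tends to infinity.\<close>

lemma du_Bois_Reymond_weak:
  fixes u h :: "real \<Rightarrow> real"
  assumes "a < b" and u: "integrable (lebesgue_on {a<..<b}) u"
    and orth: "\<And>\<phi>. \<phi> \<in> C1c a b \<Longrightarrow> (LINT x|lebesgue_on {a<..<b}. deriv \<phi> x * u x) = 0"
    and h: "continuous_on UNIV h"
  shows "(b - a) * (LINT x|lebesgue_on {a<..<b}. h x * u x)
    = (LINT x|lebesgue_on {a<..<b}. h x) * (LINT x|lebesgue_on {a<..<b}. u x)"
proof -
  let ?I = "\<lambda>f. LINT x|lebesgue_on {a<..<b}. f x"
  obtain \<kappa> :: "nat \<Rightarrow> real \<Rightarrow> real" where \<kappa>: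
    "\<And>n. \<kappa> n \<in> C1c a b" "\<And>n x. \<bar>\<kappa> n x\<bar> \<le> 1"
    "\<And>x. x \<in> {a<..<b} \<Longrightarrow> (\<lambda>n. \<kappa> n x) \<longlonglongrightarrow> 1"
    using C1c_cutoff[OF \<open>a < b\<close>] by blast
  have hS: "continuous_on S h" for S
    using h by (rule continuous_on_subset) simp
  have \<kappa>S: "continuous_on S (\<kappa> n)" for S n
    by (rule C1c_has_deriv(3)[OF \<kappa>(1)])
  have int: "integrable (lebesgue_on {a<..<b}) f" if "continuous_on {a..b} f" for f :: "real \<Rightarrow> real"
    using that by (rule integrable_continuous_open_interval)
  obtain B where B: "\<And>x. x \<in> {a..b} \<Longrightarrow> \<bar>h x\<bar> \<le> B"
    using compact_imp_bounded[OF compact_continuous_image[OF hS compact_Icc]]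
    unfolding bounded_real by (metis imageI)
  have hu: "integrable (lebesgue_on {a<..<b}) (\<lambda>x. h x * u x)"
  proof (rule Bochner_Integration.integrable_bound)
    show "integrable (lebesgue_on {a<..<b}) (\<lambda>x. B * u x)"
      using u by simp
    show "AE x in lebesgue_on {a<..<b}. norm (h x * u x) \<le> norm (B * u x)"
      using B by (intro AE_I2) (auto simp: abs_mult intro!: mult_right_mono, smt (verit) less_imp_le)
    show "(\<lambda>x. h x * u x) \<in> borel_measurable (lebesgue_on {a<..<b})"
      using int[OF hS] u by (intro borel_measurable_times) auto
  qed
  have cu: "integrable (lebesgue_on {a<..<b}) (\<lambda>x. \<kappa> n x * g x)"
    if "integrable (lebesgue_on {a<..<b}) g" for n g
  proof (rule Bochner_Integration.integrable_bound[OF that])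
    show "AE x in lebesgue_on {a<..<b}. norm (\<kappa> n x * g x) \<le> norm (g x)"
      using \<kappa>(2) by (intro AE_I2) (simp add: abs_mult mult_left_le_one_le)
    show "(\<lambda>x. \<kappa> n x * g x) \<in> borel_measurable (lebesgue_on {a<..<b})"
      using int[OF \<kappa>S] that by (intro borel_measurable_times) auto
  qed
  have eq: "?I (\<kappa> n) * ?I (\<lambda>x. \<kappa> n x * (h x * u x)) = ?I (\<lambda>x. \<kappa> n x * h x) * ?I (\<lambda>x. \<kappa> n x * u x)" for n
  proof -
    \<comment> \<open>The subtracted constant makes the integral of \<open>?k\<close> vanish and the
      factor \<open>\<kappa> n\<close> gives compact support, so \<open>?k\<close> is the derivative
      of a test function.\<close>
    let ?k = "\<lambda>x. \<kappa> n x * (h x * ?I (\<kappa> n) - ?I (\<lambda>x. \<kappa> n x * h x))"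
    obtain c d where cd: "a < c" "d < b" "\<And>x. x \<notin> {c..d} \<Longrightarrow> \<kappa> n x = 0"
      using C1c_support[OF \<kappa>(1)] by blast
    have k: "?k = (\<lambda>x. ?I (\<kappa> n) * (\<kappa> n x * h x) - ?I (\<lambda>x. \<kappa> n x * h x) * \<kappa> n x)"
      by (simp add: fun_eq_iff algebra_simps)
    have "?I ?k = 0"
      unfolding k using int[OF \<kappa>S] int[OF continuous_on_mult[OF \<kappa>S hS]] by simp
    moreover have "continuous_on UNIV ?k"
      by (intro continuous_intros \<kappa>S hS)
    ultimately obtain \<phi> where "\<phi> \<in> C1c a b" "deriv \<phi> = ?k"
      using C1c_primitive[of ?k a b c d] cd \<open>a < b\<close> by auto
    with orth[of \<phi>] have 0: "?I (\<lambda>x. ?k x * u x) = 0"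
      by simp
    have ku: "(\<lambda>x. ?k x * u x) = (\<lambda>x. ?I (\<kappa> n) * (\<kappa> n x * (h x * u x)) - ?I (\<lambda>x. \<kappa> n x * h x) * (\<kappa> n x * u x))"
      by (simp add: fun_eq_iff algebra_simps)
    show ?thesis
      using 0 cu[OF hu] cu[OF u] unfolding ku by simp
  qed
  have one: "(\<lambda>n. ?I (\<kappa> n)) \<longlonglongrightarrow> b - a"
    using cutoff_integral_tendsto[OF int[OF continuous_on_const[of _ 1]] \<kappa>]
      LINT_continuous_open_interval[of a b "\<lambda>x. 1::real"] \<open>a < b\<close> by simp
  show ?thesis
  proof (rule LIMSEQ_unique)
    show "(\<lambda>n. ?I (\<kappa> n) * ?I (\<lambda>x. \<kappa> n x * (h x * u x))) \<longlonglongrightarrow> (b - a) * ?I (\<lambda>x. h x * u x)"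
      by (intro tendsto_mult one cutoff_integral_tendsto[OF hu \<kappa>])
    show "(\<lambda>n. ?I (\<kappa> n) * ?I (\<lambda>x. \<kappa> n x * (h x * u x))) \<longlonglongrightarrow> ?I h * ?I u"
      unfolding eq by (intro tendsto_mult cutoff_integral_tendsto[OF _ \<kappa>] int hS u)
  qed
qed

text \<open>Choosing \<open>f\<close> itself as the function \<open>h\<close> in
  \<open>du_Bois_Reymond_weak\<close> gives the equality case of Cauchy-Schwarz for \<open>f\<close>
  and 1: the variance of \<open>f\<close> is 0, and continuity makes \<open>f\<close> equal to its
  mean everywhere.\<close>

lemma continuous_weak_derivative_0_imp_const:
  fixes f :: "real \<Rightarrow> real"
  assumes "a < b" and f: "continuous_on {a..b} f"
    and orth: "\<And>\<phi>. \<phi> \<in> C1c a b \<Longrightarrow> (LINT x|lebesgue_on {a<..<b}. deriv \<phi> x * f x) = 0"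
    and x: "x \<in> {a..b}"
  shows "f x = f a"
proof -
  \<comment> \<open>\<open>M\<close> is the mean value of \<open>f\<close>.\<close>
  obtain M where M: "integral {a..b} f = M * (b - a)"
    using \<open>a < b\<close> by (metis nonzero_eq_divide_eq less_irrefl right_minus_eq)
  \<comment> \<open>Clamping the argument extends \<open>f\<close> continuously to the whole line,
    as \<open>du_Bois_Reymond_weak\<close> requires.\<close>
  define h where "h x = f (max a (min b x))" for x
  have h: "continuous_on UNIV h"
    unfolding h_def using \<open>a < b\<close>
    by (intro continuous_on_compose2[OF f] continuous_intros) auto
  have hf: "h x = f x" if "x \<in> {a..b}" for x
    using that by (simp add: h_def)
  have 1: "(LINT x|lebesgue_on {a<..<b}. h x * f x) = integral {a..b} (\<lambda>x. f x * f x)"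
    by (subst LINT_continuous_open_interval)
      (auto intro!: continuous_intros f continuous_on_subset[OF h] integral_cong simp: hf)
  have 2: "(LINT x|lebesgue_on {a<..<b}. h x) = integral {a..b} f"
    by (subst LINT_continuous_open_interval)
      (auto intro!: continuous_on_subset[OF h] integral_cong simp: hf)
  have "(b - a) * integral {a..b} (\<lambda>x. f x * f x) = (integral {a..b} f)\<^sup>2"
    using du_Bois_Reymond_weak[OF \<open>a < b\<close> integrable_continuous_open_interval[OF f] orth h]
    by (simp add: 1 2 LINT_continuous_open_interval[OF f] power2_eq_square)
  also have "\<dots> = (b - a) * (M * M * (b - a))"
    by (simp add: M power2_eq_square)
  finally have sq: "integral {a..b} (\<lambda>x. f x * f x) = M * M * (b - a)"
    using \<open>a < b\<close> by simp
  \<comment> \<open>The expanded square of \<open>f x - M\<close>; the three integrals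
    cancel.\<close>
  have "((\<lambda>x. f x * f x - 2 * M * f x + M * M) has_integral
      M * M * (b - a) - 2 * M * (M * (b - a)) + M * M * (b - a)) {a..b}"
  proof (intro has_integral_add has_integral_diff has_integral_mult_right)
    show "((\<lambda>x. f x * f x) has_integral M * M * (b - a)) {a..b}"
      unfolding sq[symmetric]
      by (intro integrable_integral integrable_continuous_real continuous_intros f)
    show "(f has_integral M * (b - a)) {a..b}"
      using integrable_integral[OF integrable_continuous_real[OF f]] by (simp add: M)
    show "((\<lambda>x. M * M) has_integral M * M * (b - a)) {a..b}"
      using has_integral_const_real[of "M * M" a b] \<open>a < b\<close> by (simp add: mult.commute)
  qed
  then have "((\<lambda>x. (f x - M)\<^sup>2) has_integral 0) {a..b}"
    by (rule has_integral_eq_rhs[OF has_integral_eq[rotated]]) (auto simp: power2_eq_square algebra_simps)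
  then have "\<forall>x\<in>{a..b}. (f x - M)\<^sup>2 = 0"
    using \<open>a < b\<close> by (subst integral_eq_0_iff[symmetric])
      (auto intro!: continuous_intros f simp: integral_unique)
  then show ?thesis
    using x \<open>a < b\<close> by simp
qed

text \<open>The orthogonal complement of \<open>w\<close> is closed and contains the rational
  polynomials, which are dense.\<close>

lemma orthogonal_continuous_imp_L2_0:
  assumes "\<And>h. continuous_on UNIV h \<Longrightarrow> inner w (L2 h) = 0"
  shows "w = 0"
proof -
  have "closed {v. inner w v = 0}"
    by (intro closed_Collect_eq continuous_intros)
  moreover have "continuous_on UNIV (rat_poly as)" for as
    unfolding rat_poly_def by (intro continuous_intros)
  then have "range (\<lambda>as. L2 (rat_poly as)) \<subseteq> {v. inner w v = 0}"
    using assms by auto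
  ultimately have "closure (range (\<lambda>as. L2 (rat_poly as))) \<subseteq> {v. inner w v = 0}"
    by (rule closure_minimal[rotated])
  then have "inner w w = 0"
    using rat_poly_dense[OF square_integrable_rep[of w]] by auto
  then show ?thesis by simp
qed

lemma square_integrable_continuous:
  "continuous_on {-1..1} f \<Longrightarrow> square_integrable f"
  unfolding square_integrable_def
  by (auto intro!: borel_measurable_integrable integrable_continuous_open_interval continuous_intros)

lemma square_integrable_imp_integrable:
  "square_integrable f \<Longrightarrow> integrable (lebesgue_on Omega) f"
  using square_integrable_mult[OF square_integrable_const[of 1]] by simp

text \<open>By \<open>du_Bois_Reymond_weak\<close>, the difference of \<open>f\<close> and its mean
  is orthogonal to all continuous functions.\<close>

lemma L2_weak_derivative_0_imp_const:
  assumes f: "square_integrable f"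
    and orth: "\<And>\<phi>. \<phi> \<in> C1c (-1) 1 \<Longrightarrow> (LINT x|lebesgue_on Omega. deriv \<phi> x * f x) = 0"
  obtains c where "L2 f = L2 (\<lambda>x. c)"
proof -
  \<comment> \<open>The divisor 2 is the length of \<open>Omega\<close>.\<close>
  let ?c = "(LINT x|lebesgue_on Omega. f x) / 2"
  have "L2 f - L2 (\<lambda>x. ?c) = 0"
  proof (rule orthogonal_continuous_imp_L2_0)
    fix h :: "real \<Rightarrow> real" assume h: "continuous_on UNIV h"
    then have sh: "square_integrable h"
      by (auto intro: square_integrable_continuous continuous_on_subset)
    have "2 * (LINT x|lebesgue_on Omega. h x * f x) = (LINT x|lebesgue_on Omega. h x) * (LINT x|lebesgue_on Omega. f x)"
      using du_Bois_Reymond_weak[OF _ square_integrable_imp_integrable[OF f] orth h] by simp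
    then show "inner (L2 f - L2 (\<lambda>x. ?c)) (L2 h) = 0"
      by (simp add: inner_diff_left inner_L2 f sh mult.commute)
  qed
  then show thesis
    using that by simp
qed

section \<open>Weak derivatives\<close>

text \<open>The boundary terms vanish with the test function, so a classical derivative is also a
  weak one.\<close>

lemma C1c_integral_by_parts:
  assumes \<phi>: "\<phi> \<in> C1c a b" and "a \<le> b"
    and P: "\<And>x. (P has_real_derivative P' x) (at x)" "continuous_on UNIV P'"
  shows "(LINT x|lebesgue_on {a<..<b}. deriv \<phi> x * P x) = - (LINT x|lebesgue_on {a<..<b}. \<phi> x * P' x)"
proof -
  have P'S: "continuous_on S P'" for S
    using P(2) by (rule continuous_on_subset) simp
  have PS: "continuous_on S P" for S
    using P(1) by (meson DERIV_isCont continuous_at_imp_continuous_on)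
  note c = C1c_has_deriv(2,3)[OF \<phi>]
  have "((\<lambda>x. \<phi> x * P x) has_real_derivative deriv \<phi> x * P x + \<phi> x * P' x) (at x)" for x
    using DERIV_mult[OF C1c_has_deriv(1)[OF \<phi>] P(1)] by (simp add: mult.commute add.commute)
  then have "((\<lambda>x. deriv \<phi> x * P x + \<phi> x * P' x) has_integral \<phi> b * P b - \<phi> a * P a) {a..b}"
    using \<open>a \<le> b\<close> by (intro fundamental_theorem_of_calculus)
      (auto simp: has_real_derivative_iff_has_vector_derivative[symmetric]
        intro: has_field_derivative_at_within)
  then have "integral {a..b} (\<lambda>x. deriv \<phi> x * P x + \<phi> x * P' x) = 0"
    using C1c_boundary[OF \<phi>] by (simp add: integral_unique)
  moreover have "integral {a..b} (\<lambda>x. deriv \<phi> x * P x + \<phi> x * P' x)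
      = integral {a..b} (\<lambda>x. deriv \<phi> x * P x) + integral {a..b} (\<lambda>x. \<phi> x * P' x)"
    by (intro Henstock_Kurzweil_Integration.integral_add integrable_continuous_real continuous_on_mult c PS P'S)
  ultimately show ?thesis
    by (simp add: LINT_continuous_open_interval continuous_on_mult c PS P'S)
qed

section \<open>Weak derivatives in time\<close>

lemma L_infinity_mult_integrable:
  fixes w :: "real \<Rightarrow> 'a::{banach, second_countable_topology}"
  assumes w: "w \<in> L_infinity {a..b}" and k: "continuous_on {a..b} k"
  shows "integrable (lebesgue_on {a<..<b}) (\<lambda>t. k t *\<^sub>R w t)"
proof -
  obtain M where M: "AE t in lebesgue_on {a..b}. norm (w t) \<le> M"
    using w by (auto simp: L_infinity_def)
  obtain B where B: "\<And>t. t \<in> {a..b} \<Longrightarrow> \<bar>k t\<bar> \<le> B"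
    using compact_imp_bounded[OF compact_continuous_image[OF k compact_Icc]]
    unfolding bounded_real by (metis imageI)
  have [measurable]: "w \<in> borel_measurable (lebesgue_on {a<..<b})"
    using w by (auto simp: L_infinity_def intro: measurable_restrict_mono)
  have [measurable]: "k \<in> borel_measurable (lebesgue_on {a<..<b})"
    using integrable_continuous_open_interval[OF k] by simp
  show ?thesis
  proof (rule Bochner_Integration.integrable_bound)
    show "integrable (lebesgue_on {a<..<b}) (\<lambda>t. B * M)"
      by (intro integrable_continuous_open_interval continuous_on_const)
    have "AE t in lebesgue. t \<in> {a..b} \<longrightarrow> norm (w t) \<le> M"
      using M by (simp add: AE_restrict_space_iff)
    then have "AE t in lebesgue. t \<in> {a<..<b} \<longrightarrow> norm (k t *\<^sub>R w t) \<le> norm (B * M)"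
    proof eventually_elim
      case (elim t)
      show ?case
      proof
        assume "t \<in> {a<..<b}"
        then have "\<bar>k t\<bar> * norm (w t) \<le> B * M"
          using elim B[of t] by (intro mult_mono') auto
        then show "norm (k t *\<^sub>R w t) \<le> norm (B * M)"
          by simp
      qed
    qed
    then show "AE t in lebesgue_on {a<..<b}. norm (k t *\<^sub>R w t) \<le> norm (B * M)"
      by (simp add: AE_restrict_space_iff)
  qed measurable
qed

text \<open>Pairing with \<open>e\<close> commutes with the Bochner integral and turns the
  vector-valued weak derivative into a scalar one, which vanishes here. With \<open>e\<close> the
  constant 1 this carries the initial mean to all later times.\<close>

lemma W1_inf_inner_const:
  fixes u v :: "real \<Rightarrow> 'a::{real_inner, banach, second_countable_topology}"
  assumes "a < b" and W: "W1_inf a b u v"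
    and v0: "AE t in lebesgue_on {a..b}. inner (v t) e = 0" and "t \<in> {a..b}"
  shows "inner (u t) e = inner (u a) e"
proof (rule continuous_weak_derivative_0_imp_const[OF \<open>a < b\<close> _ _ \<open>t \<in> {a..b}\<close>])
  show "continuous_on {a..b} (\<lambda>t. inner (u t) e)"
    using W by (auto simp: W1_inf_def intro!: continuous_intros)
  fix \<phi> assume \<phi>: "\<phi> \<in> C1c a b"
  \<comment> \<open>Integrability is what allows \<open>integral_inner_left\<close> to move the
    inner product out of the integral.\<close>
  have u: "integrable (lebesgue_on {a<..<b}) (\<lambda>t. deriv \<phi> t *\<^sub>R u t)"
    and v: "integrable (lebesgue_on {a<..<b}) (\<lambda>t. \<phi> t *\<^sub>R v t)"
    using W C1c_has_deriv(2,3)[OF \<phi>] by (auto simp: W1_inf_def intro!: L_infinity_mult_integrable)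
  have "(LINT t|lebesgue_on {a<..<b}. deriv \<phi> t * inner (u t) e)
      = inner (LINT t|lebesgue_on {a<..<b}. deriv \<phi> t *\<^sub>R u t) e"
    using integral_inner_left[OF u, of e] by simp
  also have "\<dots> = - inner (LINT t|lebesgue_on {a<..<b}. \<phi> t *\<^sub>R v t) e"
    using W \<phi> by (simp add: W1_inf_def has_weak_derivative_def)
  also have "\<dots> = - (LINT t|lebesgue_on {a<..<b}. \<phi> t * inner (v t) e)"
    using integral_inner_left[OF v, of e] by simp
  also have "(LINT t|lebesgue_on {a<..<b}. \<phi> t * inner (v t) e) = 0"
  proof (rule integral_eq_zero_AE)
    have "AE t in lebesgue. t \<in> {a..b} \<longrightarrow> inner (v t) e = 0"
      using v0 by (simp add: AE_restrict_space_iff)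
    then show "AE t in lebesgue_on {a<..<b}. \<phi> t * inner (v t) e = 0"
      by (subst AE_restrict_space_iff) (auto elim: eventually_mono)
  qed
  finally show "(LINT t|lebesgue_on {a<..<b}. deriv \<phi> t * inner (u t) e) = 0"
    by simp
qed

section \<open>Weak derivatives in space\<close>

lemma C1c_square_integrable:
  assumes "\<phi> \<in> C1c a b"
  shows "square_integrable \<phi>" "square_integrable (deriv \<phi>)"
  using C1c_has_deriv(2,3)[OF assms] by (auto intro: square_integrable_continuous)

lemma inner_rep_L2:
  "square_integrable f \<Longrightarrow> inner (L2 f) g = (LINT x|lebesgue_on Omega. f x * rep_L2 g x)"
  using inner_L2[of f "rep_L2 g"] by simp

text \<open>Rephrases the definition without representatives, so that linearity of the inner product
  can be used.\<close>

lemma has_weak_dx_iff_inner: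
  "has_weak_dx f g \<longleftrightarrow> (\<forall>\<phi>\<in>C1c (-1) 1. inner (L2 (deriv \<phi>)) f = - inner (L2 \<phi>) g)"
  by (simp add: has_weak_dx_def has_weak_derivative_def inner_rep_L2 C1c_square_integrable)

lemma has_weak_dx_unique_up_to_const:
  assumes "has_weak_dx f s" "has_weak_dx g s"
  obtains c where "f - g = L2 (\<lambda>x. c)"
  using L2_weak_derivative_0_imp_const[OF square_integrable_rep[of "f - g"]] assms
  by (force simp: has_weak_dx_iff_inner inner_diff_right C1c_square_integrable
      simp flip: inner_rep_L2)

lemma inner_L2_one: "inner f (L2 (\<lambda>x. 1)) = (LINT x|lebesgue_on Omega. rep_L2 f x)"
  using inner_rep_L2[OF square_integrable_const[of 1], of f] by (simp add: inner_commute)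

lemma U_space_iff: "f \<in> U_space \<longleftrightarrow> inner f (L2 (\<lambda>x. 1)) = 0"
  by (simp add: U_space_def inner_L2_one)

text \<open>The derivative of a test function has mean zero, and the mean is a continuous
  functional, so this survives the closure that defines \<open>W12_0\<close>.\<close>

lemma W12_0_derivative_mean_zero:
  assumes "u \<in> W12_0" "has_weak_dx u u'"
  shows "inner u' (L2 (\<lambda>x. 1)) = 0"
proof -
  obtain u'' where u'': "has_weak_dx u u''"
    and cl: "(u, u'') \<in> closure ((\<lambda>\<phi>. (L2 \<phi>, L2 (deriv \<phi>))) ` C1c (-1) 1)"
    using assms(1) by (auto simp: W12_0_def)
  let ?K = "{p. inner (snd p) (L2 (\<lambda>x. 1)) = 0} :: (L2 \<times> L2) set"
  have "closed ?K"
    by (intro closed_Collect_eq continuous_intros)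
  moreover have "inner (L2 (deriv \<phi>)) (L2 (\<lambda>x. 1)) = 0" if "\<phi> \<in> C1c (-1) 1" for \<phi>
    using C1c_integral_by_parts[OF that, of "\<lambda>x. 1" "\<lambda>x. 0"] C1c_square_integrable[OF that]
    by (simp add: inner_L2)
  ultimately have "closure ((\<lambda>\<phi>. (L2 \<phi>, L2 (deriv \<phi>))) ` C1c (-1) 1) \<subseteq> ?K"
    by (intro closure_minimal) auto
  with cl have "inner u'' (L2 (\<lambda>x. 1)) = 0"
    by auto
  \<comment> \<open>The closure provides its own weak derivative \<open>u''\<close>. Its difference
    from \<open>u'\<close> is orthogonal to all test functions and hence has mean zero.\<close>
  moreover have "inner (u' - u'') (L2 (\<lambda>x. 1)) = 0"
    unfolding inner_L2_one
  proof (rule integral_eq_0_of_orthogonal_C1c)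
    show "integrable (lebesgue_on Omega) (rep_L2 (u' - u''))"
      by (rule square_integrable_imp_integrable) simp
    show "(LINT x|lebesgue_on Omega. \<phi> x * rep_L2 (u' - u'') x) = 0" if "\<phi> \<in> C1c (-1) 1" for \<phi>
      using that assms(2) u''
      by (simp add: C1c_square_integrable has_weak_dx_iff_inner inner_diff_right flip: inner_rep_L2)
  qed simp
  ultimately show ?thesis
    by (simp add: inner_diff_left)
qed

section \<open>Stresses in the interior of the yield set\<close>

lemma L2_add:
  assumes "square_integrable f" "square_integrable g"
  shows "L2 f + L2 g = L2 (\<lambda>x. f x + g x)"
  using L2_diff[OF square_integrable_add[OF assms] assms(2)] by (simp add: algebra_simps)

lemma L2_scaleR:
  assumes "square_integrable f"
  shows "c *\<^sub>R L2 f = L2 (\<lambda>x. c * f x)"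
proof -
  have "L2 (\<lambda>x. c * rep_L2 (L2 f) x) = L2 (\<lambda>x. c * f x)"
    using rep_L2_AE[OF assms]
    by (subst L2_eq_iff) (auto intro!: square_integrable_scale assms elim: eventually_mono)
  then show ?thesis
    by (simp add: scaleR_L2_def map_fun_def)
qed

lemma L2_in_Sigma_yield:
  assumes "square_integrable f"
  shows "L2 f \<in> Sigma_yield \<longleftrightarrow> (AE x in lebesgue_on Omega. \<bar>f x\<bar> \<le> 1)"
  unfolding Sigma_yield_def mem_Collect_eq
  using rep_L2_AE[OF assms] by (intro eventually_cong) (auto simp: abs_le_iff)

text \<open>The yield set has no interior points in \<open>L2\<close>, and \<open>f\<close> may come
  arbitrarily close to the yield limits, so no ball around \<open>f\<close> is available. Instead
  the step in the direction of \<open>w\<close> is scaled pointwise by the slack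
  \<open>1 - \<bar>f x\<bar>\<close>. Testing the normal with it shows that a nonnegative function,
  positive wherever \<open>w\<close> is not 0, has integral at most 0.\<close>

lemma normal_cone_Sigma_yield_interior:
  assumes f: "square_integrable f" and f1: "AE x in lebesgue_on Omega. \<bar>f x\<bar> < 1"
    and z: "z \<in> normal_cone Sigma_yield (L2 f)"
  shows "z = 0"
proof -
  define w where "w = rep_L2 z"
  have w: "square_integrable w" "L2 w = z"
    by (simp_all add: w_def)
  have [measurable]: "f \<in> borel_measurable (lebesgue_on Omega)" "w \<in> borel_measurable (lebesgue_on Omega)"
    using f w by (simp_all add: square_integrable_measurable)
  \<comment> \<open>The competitor \<open>f + g\<close> moves \<open>f\<close> in the direction of \<open>w\<close> but stays in the yield set.\<close>
  define g where "g x = (1 - \<bar>f x\<bar>) * (w x / (1 + \<bar>w x\<bar>))" for x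
  have g_le: "\<bar>g x\<bar> \<le> 1 - \<bar>f x\<bar>" if "\<bar>f x\<bar> < 1" for x
  proof -
    have "\<bar>w x / (1 + \<bar>w x\<bar>)\<bar> \<le> 1"
      by (simp add: divide_le_eq)
    then show ?thesis
      using that unfolding g_def abs_mult by (simp only: abs_of_pos diff_gt_0_iff_gt) (rule mult_left_le, auto)
  qed
  have [measurable]: "g \<in> borel_measurable (lebesgue_on Omega)"
    unfolding g_def by measurable
  have g: "square_integrable g"
    by (rule square_integrable_dominated[OF _ square_integrable_const[of 1]], measurable)
      (use f1 in eventually_elim, use g_le in force)
  have "L2 (\<lambda>x. f x + g x) \<in> Sigma_yield"
    using f1 unfolding L2_in_Sigma_yield[OF square_integrable_add[OF f g]]
    by eventually_elim (use g_le abs_triangle_ineq in fastforce)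
  then have "inner z (L2 (\<lambda>x. f x + g x) - L2 f) \<le> 0"
    using z by (simp add: normal_cone_def)
  then have le: "(LINT x|lebesgue_on Omega. w x * g x) \<le> 0"
    using inner_L2[OF w(1) g] by (simp add: w(2) L2_diff f g square_integrable_add)
  have wg: "w x * g x = (1 - \<bar>f x\<bar>) * ((w x)\<^sup>2 / (1 + \<bar>w x\<bar>))" for x
    by (simp add: g_def power2_eq_square)
  have nn: "AE x in lebesgue_on Omega. 0 \<le> w x * g x"
    using f1 by eventually_elim (simp add: wg)
  have "AE x in lebesgue_on Omega. w x * g x = 0"
    using le integral_nonneg_AE[OF nn] integral_nonneg_eq_0_iff_AE[OF square_integrable_mult[OF w(1) g] nn]
    by simp
  then have "AE x in lebesgue_on Omega. w x = 0"
    using f1 by eventually_elim (auto simp: wg add_nonneg_eq_0_iff)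
  then have "L2 w = L2 (\<lambda>x. 0)"
    using w by (subst L2_eq_iff) auto
  then show ?thesis
    by (simp add: w(2) zero_L2_def)
qed

lemma square_integrable_parabola: "square_integrable (\<lambda>x. k - m * x\<^sup>2)"
  by (intro square_integrable_continuous continuous_intros)

text \<open>A nonempty normal cone forces the parabola into the yield set, and with \<open>m\<close>
  nonzero it takes the values 1 and -1 at no more than four points. Hence it lies strictly between
  the limits almost everywhere.\<close>

lemma normal_cone_Sigma_yield_parabola:
  assumes "m \<noteq> 0" and z: "z \<in> normal_cone Sigma_yield (L2 (\<lambda>x. k - m * x\<^sup>2))"
  shows "z = 0"
proof (rule normal_cone_Sigma_yield_interior[OF square_integrable_parabola _ z])
  have fin: "finite {x. x\<^sup>2 = c}" for c :: real
    by (rule finite_subset[of _ "{sqrt c, - sqrt c}"]) (auto simp: abs_if split: if_splits)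
  let ?N = "{x. x\<^sup>2 = (k - 1) / m} \<union> {x. x\<^sup>2 = (k + 1) / m}"
  have "?N \<in> null_sets lebesgue"
    using fin by (simp add: negligible_finite flip: negligible_iff_null_sets)
  then have "AE x in lebesgue_on Omega. x \<notin> ?N"
    by (subst AE_restrict_space_iff) (auto dest!: AE_not_in elim: eventually_mono)
  moreover have "AE x in lebesgue_on Omega. \<bar>k - m * x\<^sup>2\<bar> \<le> 1"
    using z by (simp add: normal_cone_def L2_in_Sigma_yield square_integrable_parabola)
  ultimately show "AE x in lebesgue_on Omega. \<bar>k - m * x\<^sup>2\<bar> < 1"
  proof eventually_elim
    case (elim x)
    have "x\<^sup>2 = (k - y) / m" if "k - m * x\<^sup>2 = y" for y
      using \<open>m \<noteq> 0\<close> that by (simp add: field_simps)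
    from this[of 1] this[of "-1"] elim have "k - m * x\<^sup>2 \<noteq> 1" "k - m * x\<^sup>2 \<noteq> -1"
      by auto
    with elim(2) show ?case
      by linarith
  qed
qed

text \<open>A closed condition that holds almost everywhere on an open set holds at each of its
  points; at 0 the parabola has the value \<open>k\<close>.\<close>

lemma parabola_in_Sigma_yield:
  assumes "L2 (\<lambda>x. k - m * x\<^sup>2) \<in> Sigma_yield"
  shows "k \<le> 1"
proof -
  have "AE x in lebesgue_on Omega. \<bar>k - m * x\<^sup>2\<bar> \<le> 1"
    using assms by (simp add: L2_in_Sigma_yield square_integrable_parabola)
  then have "AE x\<in>Omega in lebesgue. x \<in> {x. k - m * x\<^sup>2 \<le> 1}"
    by (simp add: AE_restrict_space_iff) (auto elim!: eventually_mono)
  then have "(0::real) \<in> {x. k - m * x\<^sup>2 \<le> 1}"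
    by (rule mem_closed_if_AE_lebesgue_open[rotated 2])
      (auto intro!: closed_Collect_le continuous_intros)
  then show ?thesis by simp
qed

section \<open>The rod\<close>

text \<open>Puts both time regimes into the common shape to which the lemmas on parabolas
  apply.\<close>

lemma sigma_tilde_parabola:
  "sigma_tilde t = L2 (\<lambda>x. (if t < 1 then t / 3 else (t - 1) / 2 + 1 / 3) - min t 1 * x\<^sup>2)"
  unfolding sigma_tilde_def by (rule arg_cong[of _ _ L2]) (auto simp: fun_eq_iff algebra_simps)

text \<open>Translating a set and its base point together keeps the normals.\<close>

lemma normal_cone_Sigma_shifted:
  "normal_cone (Sigma_shifted t) y \<subseteq> normal_cone Sigma_yield (y + sigma_tilde t)"
proof
  fix z assume "z \<in> normal_cone (Sigma_shifted t) y"
  then have y: "y \<in> Sigma_shifted t" and z: "\<And>c. c \<in> Sigma_yield \<Longrightarrow> inner z (c - sigma_tilde t - y) \<le> 0"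
    by (auto simp: normal_cone_def Sigma_shifted_def)
  then show "z \<in> normal_cone Sigma_yield (y + sigma_tilde t)"
    by (auto simp: normal_cone_def Sigma_shifted_def algebra_simps)
qed

text \<open>Adding the constant \<open>y\<close> to the elastic stress only shifts the parabola,
  whose coefficient \<open>min t 1\<close> is nonzero for positive \<open>t\<close>. So the normal
  cone contributes only 0 and the rate \<open>y'\<close> is left alone.\<close>

lemma admissible_rates_subset:
  assumes "0 < t" "y \<in> V_space"
  shows "admissible_rates t y y' \<subseteq> {y'} \<inter> U_space"
proof -
  obtain c where "y = L2 (\<lambda>x. c)"
    using assms(2) by (auto simp: V_space_def)
  then obtain k where k: "y + sigma_tilde t = L2 (\<lambda>x. k - min t 1 * x\<^sup>2)"
    unfolding sigma_tilde_parabola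
    by (simp add: L2_add square_integrable_parabola add_diff_eq)
  have "z = 0" if "z \<in> normal_cone (Sigma_shifted t) y" for z
    using normal_cone_Sigma_yield_parabola[of "min t 1" z k] that normal_cone_Sigma_shifted[of t y] assms(1)
    by (auto simp: k)
  then show ?thesis
    by (auto simp: admissible_rates_def)
qed

lemma inner_const_one: "inner (L2 (\<lambda>x. c)) (L2 (\<lambda>x. 1)) = 2 * c"
  unfolding inner_L2[OF square_integrable_const square_integrable_const]
  by (subst LINT_continuous_open_interval) auto

section \<open>Empty sets along the given sweeping solution\<close>

lemma ddt_y_sol:
  assumes "t \<in> {7/3<..3}"
  shows "ddt y_sol t = L2 (\<lambda>x. - (1/2))"
  unfolding ddt_def
proof (rule vector_derivative_within)
  \<comment> \<open>Needed for uniqueness of the derivative; the filter also covers the left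
    derivative at 3.\<close>
  show "at t within {0..3} \<noteq> bot"
    using assms by (simp add: trivial_limit_within islimpt_Icc)
  have "((\<lambda>s. (- (1/2) * (s - 7/3)) *\<^sub>R L2 (\<lambda>x. 1)) has_vector_derivative (- (1/2)) *\<^sub>R L2 (\<lambda>x. 1))
      (at t within {0..3})"
    by (auto intro!: derivative_eq_intros has_vector_derivative_scaleR[THEN has_vector_derivative_eq_rhs])
  \<comment> \<open>Within the radius \<open>t - 7/3\<close> all times lie after 7/3, where
    \<open>y_sol\<close> agrees with the affine function.\<close>
  note this = has_vector_derivative_transform_within[OF this, of "t - 7/3" y_sol]
  moreover have "(- (1/2) * (s - 7/3)) *\<^sub>R L2 (\<lambda>x. 1) = y_sol s" if "7/3 \<le> s" for s
    unfolding L2_scaleR[OF square_integrable_const] y_sol_def using that by simp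
  ultimately have "(y_sol has_vector_derivative (- (1/2)) *\<^sub>R L2 (\<lambda>x. 1)) (at t within {0..3})"
    using assms by (auto simp: dist_real_def)
  then show "(y_sol has_vector_derivative L2 (\<lambda>x. - (1/2))) (at t within {0..3})"
    by (simp only: L2_scaleR[OF square_integrable_const] mult_1_right)
qed

text \<open>The only candidate is the rate -1/2, whose integral over \<open>Omega\<close> is -1 and
  not 0.\<close>

lemma admissible_rates_y_sol_empty:
  assumes "t \<in> {7/3<..3}"
  shows "admissible_rates t (y_sol t) (ddt y_sol t) = {}"
proof -
  have "y_sol t \<in> V_space"
    by (simp add: y_sol_def V_space_def)
  then have "admissible_rates t (y_sol t) (ddt y_sol t) \<subseteq> {L2 (\<lambda>x. - (1/2))} \<inter> U_space"
    using admissible_rates_subset[of t "y_sol t" "ddt y_sol t"] assms by (simp add: ddt_y_sol)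
  moreover have "L2 (\<lambda>x. - (1/2)) \<notin> U_space"
    using inner_const_one[of "- (1/2)"] by (simp add: U_space_iff)
  ultimately show ?thesis
    by auto
qed

section \<open>Nonexistence for the sweeping process\<close>

lemma AE_lebesgue_neq: "AE t in lebesgue. t \<noteq> (c::real)"
proof -
  have "{c} \<in> null_sets lebesgue"
    by (simp flip: negligible_iff_null_sets)
  from AE_not_in[OF this] show ?thesis
    by simp
qed

lemma no_sweeping_solution: "\<not> sweeping_solution \<epsilon>\<^sub>0 y \<epsilon>"
proof
  assume "sweeping_solution \<epsilon>\<^sub>0 y \<epsilon>"
  then obtain y' \<epsilon>' where W: "W1_inf 0 3 y y'"
    and rate: "AE t in lebesgue_on {0..3}. \<epsilon>' t \<in> strain_rates t (y t) (y' t)"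
    and C: "\<And>t. t \<in> {0..3} \<Longrightarrow> y t \<in> C_moving t" and y0: "y 0 = 0"
    unfolding sweeping_solution_def by (auto elim: eventually_mono)
  have U: "y' t \<in> U_space" if "t \<in> {0..3}" "t \<noteq> 0" "\<epsilon>' t \<in> strain_rates t (y t) (y' t)" for t
    using that C[of t] admissible_rates_subset[of t "y t" "y' t"]
    by (auto simp: strain_rates_def C_moving_def)
  have "AE t in lebesgue. t \<in> {0..3} \<longrightarrow> \<epsilon>' t \<in> strain_rates t (y t) (y' t)"
    using rate by (simp add: AE_restrict_space_iff)
  \<comment> \<open>Time 0 is left out because the parabola degenerates to a constant there.\<close>
  with AE_lebesgue_neq[of 0] have "AE t in lebesgue. t \<in> {0..3} \<longrightarrow> inner (y' t) (L2 (\<lambda>x. 1)) = 0"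
    by eventually_elim (use U in \<open>auto simp: U_space_iff\<close>)
  then have "AE t in lebesgue_on {0..3}. inner (y' t) (L2 (\<lambda>x. 1)) = 0"
    by (simp add: AE_restrict_space_iff)
  then have mean: "inner (y 3) (L2 (\<lambda>x. 1)) = 0"
    using W1_inf_inner_const[OF _ W, of "L2 (\<lambda>x. 1)" 3] y0 by simp
  obtain c where c: "y 3 = L2 (\<lambda>x. c)"
    using C[of 3] by (auto simp: C_moving_def V_space_def)
  with mean have "c = 0"
    by (simp add: inner_const_one)
  with c have "y 3 = 0"
    by (simp add: zero_L2_def)
  with C[of 3] have "sigma_tilde 3 \<in> Sigma_yield"
    by (auto simp: C_moving_def Sigma_shifted_def)
  then show False
    \<comment> \<open>At time 3 the elastic stress is \<open>4/3 - x\<^sup>2\<close>, above the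
      yield limit 1 in the middle of the rod.\<close>
    using parabola_in_Sigma_yield[of "4/3" 1] by (simp add: sigma_tilde_parabola)
qed

section \<open>Nonexistence for the quasi-static evolution\<close>

lemma g_load_mean:
  assumes "1 \<le> t"
  shows "inner (g_load t) (L2 (\<lambda>x. 1)) = t - 1"
proof -
  have "(u_D t has_real_derivative (t - 1) / 2) (at x)" for x
    unfolding u_D_def u_a_def u_b_def using assms by (auto intro!: derivative_eq_intros)
  then have "deriv (u_D t) = (\<lambda>x. (t - 1) / 2)"
    using DERIV_imp_deriv by blast
  then show ?thesis
    using inner_const_one[of "(t - 1) / 2"] by (simp add: g_load_def)
qed

text \<open>\<open>- min t 1 * x\<^sup>2\<close> is one stress in equilibrium with the body force,
  and any two differ by a constant.\<close>

lemma stress_parabola: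
  assumes "has_weak_dx \<sigma> s" "- s = body_force t"
  obtains k where "\<sigma> = L2 (\<lambda>x. k - min t 1 * x\<^sup>2)"
proof -
  have s: "s = L2 (\<lambda>x. - (2 * min t 1 * x))"
  proof -
    have "body_force t = L2 (\<lambda>x. 2 * min t 1 * x)"
      unfolding body_force_def by (rule arg_cong[of _ _ L2]) (auto simp: fun_eq_iff)
    moreover have "square_integrable (\<lambda>x. 2 * min t 1 * x)"
      by (intro square_integrable_continuous continuous_intros)
    ultimately have "- body_force t = L2 (\<lambda>x. - (2 * min t 1 * x))"
      using L2_scaleR[of "\<lambda>x. 2 * min t 1 * x" "-1"] by simp
    then show ?thesis
      using assms(2) by (metis minus_minus)
  qed
  \<comment> \<open>The leading 0 is kept, against simplification, so that the lemmas on parabolas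
    match with \<open>k\<close> equal to 0.\<close>
  have "has_weak_dx (L2 (\<lambda>x. 0 - min t 1 * x\<^sup>2)) s"
    unfolding has_weak_dx_iff_inner
  proof
    fix \<phi> assume \<phi>: "\<phi> \<in> C1c (-1) 1"
    have "((\<lambda>x. 0 - min t 1 * x\<^sup>2) has_real_derivative - (2 * min t 1 * x)) (at x)" for x
      by (auto intro!: derivative_eq_intros)
    moreover have "continuous_on S (\<lambda>x. - (2 * min t 1 * x))" for S
      by (intro continuous_intros)
    ultimately show "inner (L2 (deriv \<phi>)) (L2 (\<lambda>x. 0 - min t 1 * x\<^sup>2)) = - inner (L2 \<phi>) s"
      unfolding s using C1c_integral_by_parts[OF \<phi>, of "\<lambda>x. 0 - min t 1 * x\<^sup>2" "\<lambda>x. - (2 * min t 1 * x)"]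
      by (simp add: inner_L2 C1c_square_integrable[OF \<phi>] square_integrable_parabola square_integrable_continuous del: diff_0)
  qed
  from has_weak_dx_unique_up_to_const[OF assms(1) this] obtain k where
    "\<sigma> - L2 (\<lambda>x. 0 - min t 1 * x\<^sup>2) = L2 (\<lambda>x. k)" .
  then have "\<sigma> = L2 (\<lambda>x. k) + L2 (\<lambda>x. 0 - min t 1 * x\<^sup>2)"
    by (simp add: diff_eq_eq)
  also have "\<dots> = L2 (\<lambda>x. k - min t 1 * x\<^sup>2)"
    by (subst L2_add) (simp_all add: square_integrable_parabola add_diff_eq del: diff_0)
  finally show thesis
    by (rule that)
qed

lemma parabola_mean: "inner (L2 (\<lambda>x. k - m * x\<^sup>2)) (L2 (\<lambda>x. 1)) = 2 * k - 2 / 3 * m"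
proof -
  have "((\<lambda>x. k - m * x\<^sup>2) has_integral (k * 1 - m * 1 ^ 3 / 3) - (k * (-1) - m * (-1) ^ 3 / 3)) {-1..1}"
    by (rule fundamental_theorem_of_calculus)
      (auto simp: has_real_derivative_iff_has_vector_derivative[symmetric] intro!: derivative_eq_intros)
  then show ?thesis
    by (simp add: inner_L2 square_integrable_parabola LINT_continuous_open_interval
        continuous_intros integral_unique)
qed

text \<open>Since the initial plastic strain has mean zero and its rate vanishes, the stress alone
  must account for the prescribed elongation. This pushes it out of the yield set at every time in
  an interval of positive length, against the flow rule.\<close>

lemma no_quasistatic_solution:
  assumes "\<epsilon>\<^sub>0 \<in> U_space"
  shows "\<not> quasistatic_solution \<epsilon>\<^sub>0 \<epsilon> \<epsilon>_el \<epsilon>_p \<sigma>"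
proof
  let ?one = "L2 (\<lambda>x. 1)"
  assume "quasistatic_solution \<epsilon>\<^sub>0 \<epsilon> \<epsilon>_el \<epsilon>_p \<sigma>"
  then obtain \<epsilon>_p' where W: "W1_inf 0 3 \<epsilon>_p \<epsilon>_p'" and p0: "\<epsilon>_p 0 = \<epsilon>\<^sub>0"
    and eps: "\<And>t. t \<in> {0..3} \<Longrightarrow> \<exists>u\<in>W12_0. \<exists>u'. has_weak_dx u u' \<and> \<epsilon> t = u' + g_load t"
    and sum: "\<And>t. t \<in> {0..3} \<Longrightarrow> \<epsilon> t = \<epsilon>_el t + \<epsilon>_p t"
    and hooke: "\<And>t. t \<in> {0..3} \<Longrightarrow> \<sigma> t = \<epsilon>_el t"
    and force: "\<And>t. t \<in> {0..3} \<Longrightarrow> \<exists>s. has_weak_dx (\<sigma> t) s \<and> - s = body_force t"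
    and flow: "AE t in lebesgue_on {0..3}. \<epsilon>_p' t \<in> normal_cone Sigma_yield (\<sigma> t)"
    unfolding quasistatic_solution_def
    by - (elim exE conjE, rule that, (assumption | drule bspec, assumption, elim conjE, assumption)+)
  have flow: "AE t in lebesgue. t \<in> {0..3} \<longrightarrow> \<epsilon>_p' t \<in> normal_cone Sigma_yield (\<sigma> t)"
    using flow by (simp add: AE_restrict_space_iff)
  from AE_lebesgue_neq[of 0] flow have "AE t in lebesgue. t \<in> {0..3} \<longrightarrow> inner (\<epsilon>_p' t) ?one = 0"
  proof eventually_elim
    case (elim t)
    show ?case
    proof
      assume t: "t \<in> {0..3}"
      obtain k where "\<sigma> t = L2 (\<lambda>x. k - min t 1 * x\<^sup>2)"
        using force[OF t] stress_parabola by metis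
      then show "inner (\<epsilon>_p' t) ?one = 0"
        using normal_cone_Sigma_yield_parabola[of "min t 1" "\<epsilon>_p' t" k] elim t by auto
    qed
  qed
  then have "AE t in lebesgue_on {0..3}. inner (\<epsilon>_p' t) ?one = 0"
    by (simp add: AE_restrict_space_iff)
  then have mean_p: "inner (\<epsilon>_p t) ?one = 0" if "t \<in> {0..3}" for t
    using W1_inf_inner_const[OF _ W _ that] p0 assms by (simp add: U_space_iff)
  have "\<sigma> t \<notin> Sigma_yield" if t: "t \<in> {7/3<..<3}" for t
  proof
    assume "\<sigma> t \<in> Sigma_yield"
    have t03: "t \<in> {0..3}"
      using t by auto
    obtain k where k: "\<sigma> t = L2 (\<lambda>x. k - min t 1 * x\<^sup>2)"
      using force[OF t03] stress_parabola by metis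
    obtain u u' where "u \<in> W12_0" "has_weak_dx u u'" "\<epsilon> t = u' + g_load t"
      using eps[OF t03] by blast
    then have "inner (\<epsilon> t) ?one = t - 1"
      using t by (simp add: inner_add_left W12_0_derivative_mean_zero g_load_mean)
    then have "inner (\<sigma> t) ?one = t - 1"
      using sum[OF t03] hooke[OF t03] mean_p[OF t03] by (simp add: inner_add_left)
    \<comment> \<open>Solving for \<open>k\<close> gives \<open>t / 2 - 1 / 6\<close>, which exceeds
      1 exactly when \<open>t\<close> exceeds 7/3.\<close>
    then have "2 * k - 2 / 3 = t - 1"
      using parabola_mean[of k 1] t by (simp add: k min_def)
    moreover have "k \<le> 1"
      using \<open>\<sigma> t \<in> Sigma_yield\<close> unfolding k by (rule parabola_in_Sigma_yield)
    ultimately show False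
      using t by simp
  qed
  \<comment> \<open>The empty set is closed, so it would contain every point of the open interval;
    8/3 is one such point.\<close>
  with flow have "AE t\<in>{7/3<..<3} in lebesgue. t \<in> ({} :: real set)"
    by (auto simp: normal_cone_def elim!: eventually_mono)
  from mem_closed_if_AE_lebesgue_open[OF _ _ this, of "8/3"] show False
    by simp
qed

theorem mainTheorem4:
  shows "(\<forall>t\<in>{t_star<..T_end}.
            admissible_rates t (y_sol t) (ddt y_sol t) = {} \<and>
            strain_rates t (y_sol t) (ddt y_sol t) = {}) \<and>
         (\<forall>\<epsilon>\<^sub>0. \<not> (\<exists>y \<epsilon>. sweeping_solution \<epsilon>\<^sub>0 y \<epsilon>)) \<and>
         (\<forall>\<epsilon>\<^sub>0\<in>U_space. \<not> (\<exists>\<epsilon> \<epsilon>_el \<epsilon>_p \<sigma>. quasistatic_solution \<epsilon>\<^sub>0 \<epsilon> \<epsilon>_el \<epsilon>_p \<sigma>))"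
  using admissible_rates_y_sol_empty no_sweeping_solution no_quasistatic_solution
  by (auto simp: strain_rates_def)

end
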